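(* Let $F$ be a unitary operator on $\ell^2(\mathbb{N})$, let $p$ be a probability distribution on $\mathbb{N}$, let $m\in\mathbb{N}$, $m\ge1$, and let $S$, $D$, $\hat I$ be the associated sampling, weighting and support-projection operators. Let $G$ be a $(k,d)$-generalized generative network with layer widths $2\le k=k_0\le\dots\le k_d$, with range $R(G)$, and let $\mathcal{T}=R(G)-R(G)=\{a-b:a,b\in R(G)\}$. Let $\varepsilon>0$ and $\delta\in(0,1)$, assume $\mu_{\mathcal{T}}(F,p)\ge1$, and assume $$m\ge\frac{4\mu_{\mathcal{T}}(F,p)^2}{\delta^2}\left[2kd\log\left(\frac{2ek_d}{k}\right)+\log\left(\frac{4k}{\varepsilon}\right)\right].$$ Then, with probability at least $1-\varepsilon$ over the draw of $S$, $$\sup_{x\in\mathcal{T},\,\|x\|=1}\left|\frac1m\|SDFx\|^2-\|\hat IFx\|^2\right|\le\delta.$$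
   Context: $\ell^2(\mathbb{N})$ is the complex Hilbert space of square-summable sequences, with canonical basis $(e_j)_{j\in\mathbb{N}}$. Generative network. Fix $d\ge1$ and integers $2\le k=k_0\le k_1\le\dots\le k_d$, matrices $W^{(i)}\in\mathbb{R}^{k_i\times k_{i-1}}$ ($1\le i\le d$) and a linear map $W:\mathbb{C}^{k_d}\to\ell^2(\mathbb{N})$. A $(k,d)$-generalized generative network is the map $G:\mathbb{R}^k\to\ell^2(\mathbb{N})$, $G(z)=W\sigma(W^{(d)}\sigma(\cdots W^{(2)}\sigma(W^{(1)}z)))$, where $\sigma(x)=\max(0,x)$ is applied componentwise. Its range $R(G)$ is a finite union of polyhedral convex cones contained in a finite-dimensional subspace, and so is $\mathcal{T}=R(G)-R(G)$. Operators associated with $p$ and $m$. $s_1,\dots,s_m$ are i.i.d. random vectors with $\mathbb{P}(s_i=e_j)=p_j$ for all $j\in\mathbb{N}$; $S$ is defined by $(Sx)_i=\langle x,s_i\rangle$, $1\le i\le m$. $D$ is the diagonal operator $(Dx)_j=x_j/\sqrt{p_j}$ if $p_j>0$ and $(Dx)_j=0$ if $p_j=0$; $SDx$ is understood coordinatewise, i.e. $(SDx)_i=(Dx)_j$ when $s_i=e_j$. $\hat I=\mathrm{diag}(\mathbf{1}_{\operatorname{supp}p})$ is the coordinate projection onto the indices $j$ with $p_j>0$. Local coherence. For a finite union of convex cones $\mathcal{U}=\bigcup_{i=1}^N\mathcal{C}_i\subseteq\ell^2(\mathbb{N})$ contained in a finite-dimensional subspace, let $\Delta(\mathcal{U})=\bigcup_{i=1}^N\operatorname{span}(\mathcal{C}_i)$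 (this set does not depend on the decomposition). The local coherence of $\mathcal{U}$ with respect to $F$ is $\alpha_j=\sup_{x\in\Delta(\mathcal{U}),\|x\|=1}|(Fx)_j|$, $j\in\mathbb{N}$ (with $\sup\emptyset=0$). $\mu_{\mathcal{U}}(F,p)$ is the smallest constant such that $\alpha_j\le\mu_{\mathcal{U}}(F,p)\sqrt{p_j}$ for all $j$ with $p_j>0$ (it is $+\infty$ if there is no such finite constant). *)

theory Defs
  imports "Jordan_Normal_Form.Matrix" "HOL-Probability.Probability"
begin

section \<open>The complex Hilbert space of square-summable sequences\<close>

typedef ell2 = "{x :: nat \<Rightarrow> complex. summable (\<lambda>j. (cmod (x j))\<^sup>2)}"
  morphisms coord Abs_ell2
  by (rule exI[of _ "\<lambda>_. 0"]) simp

setup_lifting type_definition_ell2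

lemma summable_sq_add:
  fixes x y :: "nat \<Rightarrow> complex"
  assumes "summable (\<lambda>j. (cmod (x j))\<^sup>2)" and "summable (\<lambda>j. (cmod (y j))\<^sup>2)"
  shows "summable (\<lambda>j. (cmod (x j + y j))\<^sup>2)"
proof (rule summable_comparison_test')
  show "summable (\<lambda>j. 2 * (cmod (x j))\<^sup>2 + 2 * (cmod (y j))\<^sup>2)"
    using assms by (intro summable_add summable_mult)
  fix j :: nat assume "0 \<le> j"
  have "(cmod (x j + y j))\<^sup>2 \<le> (cmod (x j) + cmod (y j))\<^sup>2"
    by (intro power_mono norm_triangle_ineq) simp
  also have "\<dots> \<le> 2 * (cmod (x j))\<^sup>2 + 2 * (cmod (y j))\<^sup>2"
    using sum_squares_bound[of "cmod (x j)" "cmod (y j)"] by (simp add: power2_sum)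
  finally show "norm ((cmod (x j + y j))\<^sup>2) \<le> 2 * (cmod (x j))\<^sup>2 + 2 * (cmod (y j))\<^sup>2"
    by simp
qed

lemma summable_sq_scale:
  fixes x :: "nat \<Rightarrow> complex"
  assumes "summable (\<lambda>j. (cmod (x j))\<^sup>2)"
  shows "summable (\<lambda>j. (cmod (c * x j))\<^sup>2)"
  using summable_mult[OF assms, of "(cmod c)\<^sup>2"] by (simp add: norm_mult power_mult_distrib)

lemma summable_cinner:
  fixes x y :: "nat \<Rightarrow> complex"
  assumes "summable (\<lambda>j. (cmod (x j))\<^sup>2)" and "summable (\<lambda>j. (cmod (y j))\<^sup>2)"
  shows "summable (\<lambda>j. x j * cnj (y j))"
proof (rule summable_comparison_test')
  show "summable (\<lambda>j. (cmod (x j))\<^sup>2 + (cmod (y j))\<^sup>2)"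
    using assms by (intro summable_add)
  fix j :: nat assume "0 \<le> j"
  have "0 \<le> cmod (x j) * cmod (y j)" by simp
  then show "norm (x j * cnj (y j)) \<le> (cmod (x j))\<^sup>2 + (cmod (y j))\<^sup>2"
    using sum_squares_bound[of "cmod (x j)" "cmod (y j)"] unfolding norm_mult complex_mod_cnj
    by linarith
qed

lemma ell2_summable: "summable (\<lambda>j. (cmod (coord x j))\<^sup>2)"
  using coord[of x] by simp

lift_definition scaleC :: "complex \<Rightarrow> ell2 \<Rightarrow> ell2" (infixr "*\<^sub>C" 75)
  is "\<lambda>c x j. c * x j" by (rule summable_sq_scale)

definition cinner :: "ell2 \<Rightarrow> ell2 \<Rightarrow> complex" where
  "cinner x y = (\<Sum>j. coord x j * cnj (coord y j))"

lift_definition basis_vec :: "nat \<Rightarrow> ell2" is "\<lambda>i j. if j = i then 1 else 0"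
proof -
  fix i :: nat
  show "summable (\<lambda>j. (cmod (if j = i then 1 else 0))\<^sup>2)"
    by (rule summable_finite[of "{i}"]) auto
qed

instantiation ell2 :: real_vector
begin
lift_definition zero_ell2 :: ell2 is "\<lambda>_. 0" by simp
lift_definition plus_ell2 :: "ell2 \<Rightarrow> ell2 \<Rightarrow> ell2" is "\<lambda>x y j. x j + y j"
  by (rule summable_sq_add)
lift_definition uminus_ell2 :: "ell2 \<Rightarrow> ell2" is "\<lambda>x j. - x j" by simp
lift_definition minus_ell2 :: "ell2 \<Rightarrow> ell2 \<Rightarrow> ell2" is "\<lambda>x y j. x j - y j"
  using summable_sq_add[of _ "\<lambda>j. - _ j"] by simp
lift_definition scaleR_ell2 :: "real \<Rightarrow> ell2 \<Rightarrow> ell2" is "\<lambda>r x j. complex_of_real r * x j"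
  by (rule summable_sq_scale)
instance
  by standard (transfer; simp add: fun_eq_iff algebra_simps)+
end

global_interpretation ell2: vector_space scaleC
  by standard (transfer; simp add: fun_eq_iff algebra_simps)+

lemma Re_cinner: "Re (cinner x y) = (\<Sum>j. Re (coord x j * cnj (coord y j)))"
  unfolding cinner_def
  by (rule bounded_linear.suminf[OF bounded_linear_Re summable_cinner[OF ell2_summable ell2_summable]])

lemma summable_Re_cinner: "summable (\<lambda>j. Re (coord x j * cnj (coord y j)))"
  by (rule bounded_linear.summable[OF bounded_linear_Re summable_cinner[OF ell2_summable ell2_summable]])

lemma Re_cinner_self: "Re (cinner x x) = (\<Sum>j. (cmod (coord x j))\<^sup>2)"
  unfolding Re_cinner by (simp add: complex_norm_square[symmetric])

instantiation ell2 :: real_inner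
begin
definition inner_ell2 :: "ell2 \<Rightarrow> ell2 \<Rightarrow> real" where "inner_ell2 x y = Re (cinner x y)"
definition norm_ell2 :: "ell2 \<Rightarrow> real" where "norm_ell2 x = sqrt (\<Sum>j. (cmod (coord x j))\<^sup>2)"
definition dist_ell2 :: "ell2 \<Rightarrow> ell2 \<Rightarrow> real" where "dist_ell2 x y = norm (x - y)"
definition sgn_ell2 :: "ell2 \<Rightarrow> ell2" where "sgn_ell2 x = x /\<^sub>R norm x"
definition uniformity_ell2 :: "(ell2 \<times> ell2) filter" where
  "uniformity_ell2 = (INF e\<in>{0<..}. principal {(x, y). dist x y < e})"
definition open_ell2 :: "ell2 set \<Rightarrow> bool" where
  "open_ell2 U \<longleftrightarrow> (\<forall>x\<in>U. eventually (\<lambda>(x', y). x' = x \<longrightarrow> y \<in> U) uniformity)"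
instance
proof
  fix x y z :: ell2 and r :: real and U :: "ell2 set"
  show "dist x y = norm (x - y)" by (rule dist_ell2_def)
  show "sgn x = x /\<^sub>R norm x" by (rule sgn_ell2_def)
  show "uniformity = (INF e\<in>{0<..}. principal {(x, y :: ell2). dist x y < e})"
    by (rule uniformity_ell2_def)
  show "open U \<longleftrightarrow> (\<forall>x\<in>U. eventually (\<lambda>(x', y). x' = x \<longrightarrow> y \<in> U) uniformity)"
    by (rule open_ell2_def)
  show "inner x y = inner y x"
    unfolding inner_ell2_def Re_cinner by (simp add: mult.commute)
  show "inner (x + y) z = inner x z + inner y z"
    unfolding inner_ell2_def Re_cinner
    by (subst suminf_add[OF summable_Re_cinner summable_Re_cinner])
       (simp add: plus_ell2.rep_eq algebra_simps)
  show "inner (r *\<^sub>R x) y = r * inner x y"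
    unfolding inner_ell2_def Re_cinner
    by (subst suminf_mult[OF summable_Re_cinner, symmetric])
       (simp add: scaleR_ell2.rep_eq algebra_simps)
  show "0 \<le> inner x x"
    unfolding inner_ell2_def Re_cinner_self by (intro suminf_nonneg ell2_summable) simp
  show "inner x x = 0 \<longleftrightarrow> x = 0"
    unfolding inner_ell2_def Re_cinner_self
    by (subst suminf_eq_zero_iff[OF ell2_summable])
       (auto simp: zero_ell2.rep_eq fun_eq_iff simp flip: coord_inject)
  show "norm x = sqrt (inner x x)"
    unfolding inner_ell2_def Re_cinner_self norm_ell2_def ..
qed
end

definition unitary_op :: "(ell2 \<Rightarrow> ell2) \<Rightarrow> bool" where
  "unitary_op F \<longleftrightarrow> Vector_Spaces.linear (*\<^sub>C) (*\<^sub>C) F \<and> surj F \<and>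
     (\<forall>x y. cinner (F x) (F y) = cinner x y)"


section \<open>Generalized generative networks\<close>

definition relu :: "real Matrix.vec \<Rightarrow> real Matrix.vec" where
  "relu = map_vec (\<lambda>t. max 0 t)"

primrec layer :: "(nat \<Rightarrow> real mat) \<Rightarrow> nat \<Rightarrow> real Matrix.vec \<Rightarrow> real Matrix.vec" where
  "layer A 0 z = z"
| "layer A (Suc i) z = relu (A (Suc i) *\<^sub>v layer A i z)"

definition network ::
  "nat \<Rightarrow> (nat \<Rightarrow> real mat) \<Rightarrow> (complex Matrix.vec \<Rightarrow> ell2) \<Rightarrow> real Matrix.vec \<Rightarrow> ell2" where
  "network d A W z = W (map_vec complex_of_real (layer A d z))"

definition clinear_on_vec :: "nat \<Rightarrow> (complex Matrix.vec \<Rightarrow> ell2) \<Rightarrow> bool" where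
  "clinear_on_vec n W \<longleftrightarrow>
     (\<forall>u\<in>carrier_vec n. \<forall>v\<in>carrier_vec n. W (u + v) = W u + W v) \<and>
     (\<forall>c. \<forall>u\<in>carrier_vec n. W (c \<cdot>\<^sub>v u) = c *\<^sub>C W u)"

text \<open>The layer widths are \<open>n 0 \<le> n 1 \<le> \<dots> \<le> n d\<close>; \<open>A i\<close> is the \<open>i\<close>-th weight matrix for
  \<open>1 \<le> i \<le> d\<close>, and its values at other indices are irrelevant.\<close>
definition generative_network ::
  "nat \<Rightarrow> nat \<Rightarrow> (nat \<Rightarrow> nat) \<Rightarrow> (real Matrix.vec \<Rightarrow> ell2) \<Rightarrow> bool" where
  "generative_network k d n G \<longleftrightarrow>
     1 \<le> d \<and> 2 \<le> k \<and> n 0 = k \<and> (\<forall>i<d. n i \<le> n (Suc i)) \<and>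
     (\<exists>A W. (\<forall>i\<in>{1..d}. A i \<in> carrier_mat (n i) (n (i - 1))) \<and>
            clinear_on_vec (n d) W \<and> (\<forall>z\<in>carrier_vec k. G z = network d A W z))"


section \<open>Local coherence\<close>

definition cone_decomposition :: "ell2 set set \<Rightarrow> ell2 set \<Rightarrow> bool" where
  "cone_decomposition \<C> U \<longleftrightarrow> finite \<C> \<and> (\<forall>C\<in>\<C>. convex_cone C) \<and> U = \<Union>\<C>"

text \<open>The spans are complex linear.  The choice of the decomposition is immaterial, see
  \<open>Delta_eq\<close> below.\<close>
definition Delta :: "ell2 set \<Rightarrow> ell2 set" where
  "Delta U = (\<Union>C\<in>(SOME \<C>. cone_decomposition \<C> U). ell2.span C)"

lemma scaleR_eq_scaleC: "r *\<^sub>R x = complex_of_real r *\<^sub>C x"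
  by transfer simp

lemma convex_covered_by_subspaces:
  assumes "finite \<V>" "\<And>V. V \<in> \<V> \<Longrightarrow> ell2.subspace V" "convex C" "C \<noteq> {}" "C \<subseteq> \<Union>\<V>"
  shows "\<exists>V\<in>\<V>. C \<subseteq> V"
  using assms
proof (induction \<V> rule: finite_induct)
  case empty
  then show ?case by simp
next
  case (insert V \<V>)
  show ?case
  proof (cases "C \<subseteq> V \<or> C \<subseteq> \<Union>\<V>")
    case True
    then show ?thesis using insert by auto
  next
    case False
    then obtain x y where xy: "x \<in> C" "x \<notin> \<Union>\<V>" "y \<in> C" "y \<notin> V" by blast
    then have "x \<in> V" using insert.prems by auto
    define f where "f t = x + t *\<^sub>R (y - x)" for t :: real
    have fC: "f t \<in> \<Union>(insert V \<V>)" if "t \<in> {0<..<1}" for t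
    proof -
      have "(1 - t) *\<^sub>R x + t *\<^sub>R y \<in> C"
        using that xy insert.prems by (intro convexD) auto
      also have "(1 - t) *\<^sub>R x + t *\<^sub>R y = f t" by (simp add: f_def algebra_simps)
      finally show ?thesis using insert.prems by blast
    qed
    have "\<exists>V'\<in>insert V \<V>. infinite {t \<in> {0<..<1}. f t \<in> V'}"
    proof (rule ccontr)
      assume "\<not> ?thesis"
      then have "finite (\<Union>V'\<in>insert V \<V>. {t \<in> {0<..<1}. f t \<in> V'})" using insert by blast
      moreover have "{0<..<1} \<subseteq> (\<Union>V'\<in>insert V \<V>. {t \<in> {0<..<1}. f t \<in> V'})" using fC by blast
      ultimately have "finite {0<..<1::real}" by (rule rev_finite_subset)
      moreover have "infinite {0<..<1::real}" by (rule infinite_Ioo) simp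
      ultimately show False by contradiction
    qed
    then obtain V' where V': "V' \<in> insert V \<V>" "infinite {t \<in> {0<..<1}. f t \<in> V'}" by blast
    obtain s where s: "f s \<in> V'"
      using infinite_imp_nonempty[OF V'(2)] by auto
    have "infinite ({t \<in> {0<..<1}. f t \<in> V'} - {s})" using V'(2) by simp
    from infinite_imp_nonempty[OF this] obtain t where t: "f t \<in> V'" "t \<noteq> s" by auto
    have sub: "ell2.subspace V'" using V' insert.prems by auto
    have scR: "r *\<^sub>R v \<in> V'" if "v \<in> V'" for r v
      unfolding scaleR_eq_scaleC by (rule ell2.subspace_scale[OF sub that])
    have "f t - f s = (t - s) *\<^sub>R (y - x)" by (simp add: f_def algebra_simps)
    then have "y - x = inverse (t - s) *\<^sub>R (f t - f s)" using t by simp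
    then have yx: "y - x \<in> V'" by (simp only: scR ell2.subspace_diff[OF sub t(1) s])
    have "f s - s *\<^sub>R (y - x) \<in> V'" by (rule ell2.subspace_diff[OF sub s scR[OF yx]])
    then have xV': "x \<in> V'" by (simp add: f_def)
    have "y \<in> V'" using ell2.subspace_add[OF sub yx xV'] by simp
    then show ?thesis using xV' xy V' by auto
  qed
qed

lemma span_decomposition_mono:
  assumes "cone_decomposition \<C> U" and "cone_decomposition \<D> U"
  shows "(\<Union>C\<in>\<C>. ell2.span C) \<subseteq> (\<Union>D\<in>\<D>. ell2.span D)"
proof (rule UN_least)
  fix C assume C: "C \<in> \<C>"
  have "C \<subseteq> \<Union>(ell2.span ` \<D>)"
    using assms C ell2.span_superset unfolding cone_decomposition_def by blast
  moreover have "convex C" "C \<noteq> {}" "finite (ell2.span ` \<D>)"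
    using assms C unfolding cone_decomposition_def convex_cone_def by auto
  ultimately obtain D where "D \<in> \<D>" "C \<subseteq> ell2.span D"
    using convex_covered_by_subspaces[of "ell2.span ` \<D>" C] ell2.subspace_span by blast
  then show "ell2.span C \<subseteq> (\<Union>D\<in>\<D>. ell2.span D)"
    using ell2.span_minimal[OF _ ell2.subspace_span] by blast
qed

lemma Delta_eq:
  assumes "cone_decomposition \<C> U"
  shows "Delta U = (\<Union>C\<in>\<C>. ell2.span C)"
  unfolding Delta_def
  using span_decomposition_mono[OF assms] span_decomposition_mono[OF _ assms]
    someI[of "\<lambda>\<C>. cone_decomposition \<C> U", OF assms] by blast

text \<open>Inserting \<open>0\<close> implements the convention that the supremum of the empty set is \<open>0\<close>
  (for \<open>ereal\<close> it would be \<open>-\<infinity>\<close>).\<close>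
definition local_coherence :: "(ell2 \<Rightarrow> ell2) \<Rightarrow> ell2 set \<Rightarrow> nat \<Rightarrow> ereal" where
  "local_coherence F U j =
     Sup (insert 0 {ereal (cmod (coord (F x) j)) | x. x \<in> Delta U \<and> norm x = 1})"

text \<open>\<open>\<infinity>\<close> always belongs to the set below, and the infimum is attained
  (\<open>local_coherence_le\<close>).\<close>
definition coherence_mu :: "ell2 set \<Rightarrow> (ell2 \<Rightarrow> ell2) \<Rightarrow> nat pmf \<Rightarrow> ereal" where
  "coherence_mu U F p =
     Inf {c. \<forall>j. pmf p j > 0 \<longrightarrow> local_coherence F U j \<le> c * ereal (sqrt (pmf p j))}"

lemma local_coherence_le:
  assumes "pmf p j > 0"
  shows "local_coherence F U j \<le> coherence_mu U F p * ereal (sqrt (pmf p j))"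
proof -
  have r: "0 < ereal (sqrt (pmf p j))" "ereal (sqrt (pmf p j)) \<noteq> \<infinity>" using assms by auto
  have "local_coherence F U j / ereal (sqrt (pmf p j)) \<le> coherence_mu U F p"
    unfolding coherence_mu_def
  proof (rule Inf_greatest)
    fix c
    assume "c \<in> {c. \<forall>j. pmf p j > 0 \<longrightarrow> local_coherence F U j \<le> c * ereal (sqrt (pmf p j))}"
    then have "local_coherence F U j \<le> ereal (sqrt (pmf p j)) * c"
      using assms by (simp add: mult.commute)
    then show "local_coherence F U j / ereal (sqrt (pmf p j)) \<le> c"
      by (simp only: ereal_divide_le_pos[OF r])
  qed
  then show ?thesis by (simp only: ereal_divide_le_pos[OF r] mult.commute)
qed


section \<open>Sampling, weighting and support projection\<close>

text \<open>\<open>sampling s y i\<close> is \<open>y\<^sub>j\<close> when \<open>s i\<close> is the basis vector with index \<open>j\<close>, which agrees with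
  the inner product with \<open>s i\<close> on square-summable sequences (\<open>sampling_coord\<close>) but also makes sense
  for the possibly unbounded image of the operator \<open>weighting\<close>.  The value \<open>0\<close> for other vectors is
  immaterial, since the random vectors are almost surely basis vectors.\<close>
definition sampling :: "(nat \<Rightarrow> ell2) \<Rightarrow> (nat \<Rightarrow> complex) \<Rightarrow> nat \<Rightarrow> complex" where
  "sampling s y i = (if s i \<in> range basis_vec then y (THE j. s i = basis_vec j) else 0)"

lemma inj_basis_vec: "inj basis_vec"
  by (rule injI, transfer) (metis zero_neq_one)

lemma sampling_basis_vec: "s i = basis_vec j \<Longrightarrow> sampling s y i = y j"
  by (auto simp: sampling_def inj_eq[OF inj_basis_vec])

lemma sampling_coord:
  assumes "s i \<in> range basis_vec"
  shows "sampling s (coord x) i = cinner x (s i)"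
proof -
  obtain j where j: "s i = basis_vec j" using assms by auto
  have "cinner x (basis_vec j) = (\<Sum>l\<in>{j}. coord x l * cnj (coord (basis_vec j) l))"
    unfolding cinner_def by (rule suminf_finite) (auto simp: basis_vec.rep_eq)
  then show ?thesis using j by (simp add: sampling_basis_vec basis_vec.rep_eq)
qed

text \<open>\<open>weighting p x\<close> lives in the space of all sequences because \<open>1 / sqrt (pmf p j)\<close> need not be
  bounded.\<close>
definition weighting :: "nat pmf \<Rightarrow> ell2 \<Rightarrow> nat \<Rightarrow> complex" where
  "weighting p x j = (if pmf p j > 0 then coord x j / complex_of_real (sqrt (pmf p j)) else 0)"

lift_definition support_proj :: "nat pmf \<Rightarrow> ell2 \<Rightarrow> ell2" is
  "\<lambda>p x j. if pmf p j > 0 then x j else 0"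
proof -
  fix p :: "nat pmf" and x :: "nat \<Rightarrow> complex"
  assume "summable (\<lambda>j. (cmod (x j))\<^sup>2)"
  then show "summable (\<lambda>j. (cmod (if pmf p j > 0 then x j else 0))\<^sup>2)"
    by (rule summable_comparison_test'[where N = 0]) auto
qed

end

(* Matrix concentration on each cone plus a union bound over the linear pieces of the network.

   On every sign cone of its layers the network is linear; a halfspace pattern on R^k shatters at
   most k neurons, so the Sauer-Shelah lemma bounds the number of pieces per layer by (e n_i / k)^k,
   and T is a union of at most (e n_d / k)^(2kd) convex cones of dimension at most 2k.

   On one such cone, the deviation is the quadratic form of a sum of i.i.d. self-adjoint operators.
   The Ahlswede-Winter argument is run with Euler's approximation (1 + A/N)^N, N = 2^n, in place of
   exp A, so that neither a matrix exponential nor the spectral theorem is needed: the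
   Golden-Thompson inequality becomes tr (AC)^N <= tr (A^N C^N), which follows from
   Cauchy-Schwarz, up to an error O(1/N) that vanishes as N tends to infinity. *)
theory Submission
  imports Defs
begin

section \<open>Trace inequalities for self-adjoint operators\<close>

text \<open>Through the trace, the dimension enters the failure probability as a factor rather than
  exponentially, as it would with a net of the unit sphere. Scalars are real: a network is only
  real-linear on its pieces, so the operators act on the real span of a cone, of dimension at most
  \<open>2 * k\<close>, while coherence is measured on the complex span; the inclusion of the first
  span in the second links the two. Origin of the constants: \<open>4 * k\<close> is the dimension
  bound \<open>2 * k\<close> times two for the sign of the deviation. With \<open>R\<close> the
  squared coherence and \<open>\<theta>\<close> the Laplace parameter, the exponent is
  \<open>m * (\<theta>\<^sup>2 * R - \<theta> * \<delta>)\<close>, minimal at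
  \<open>\<theta> = \<delta> / (2 * R)\<close>; its value
  \<open>- m * \<delta>\<^sup>2 / (4 * R)\<close> explains the factor 4 in front of the squared
  coherence. There \<open>\<theta> * R = \<delta> / 2\<close>, so the scaled centred operators have
  norm at most one. The supremum over the uncountable set \<open>T\<close> raises no measurability
  question: the event depends only on \<open>m\<close> sampled indices, which take countably many
  values.\<close>

locale onb =
  fixes B :: "'a::real_inner set"
  assumes finite_B: "finite B"
    and inner_B: "b \<in> B \<Longrightarrow> c \<in> B \<Longrightarrow> inner b c = (if b = c then 1 else 0)"
begin

section \<open>Adjoints, traces and norm bounds on a finite-dimensional real subspace\<close>

definition endo :: "('a \<Rightarrow> 'a) \<Rightarrow> bool" where
  "endo A \<longleftrightarrow> linear A \<and> (\<forall>x\<in>span B. A x \<in> span B)"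

text \<open>A relation rather than an adjoint function, because outside \<open>span B\<close> the
  adjoint is not determined; \<open>adj_pair A A\<close> is self-adjointness on
  \<open>span B\<close>.\<close>

definition adj_pair :: "('a \<Rightarrow> 'a) \<Rightarrow> ('a \<Rightarrow> 'a) \<Rightarrow> bool" where
  "adj_pair A A' \<longleftrightarrow> endo A \<and> endo A' \<and> (\<forall>x\<in>span B. \<forall>y\<in>span B. inner (A x) y = inner x (A' y))"

definition otrace :: "('a \<Rightarrow> 'a) \<Rightarrow> real" where
  "otrace A = (\<Sum>b\<in>B. inner (A b) b)"

definition norm_bound :: "('a \<Rightarrow> 'a) \<Rightarrow> real \<Rightarrow> bool" where
  "norm_bound A c \<longleftrightarrow> (\<forall>x\<in>span B. norm (A x) \<le> c * norm x)"

lemma endo_in: "endo A \<Longrightarrow> x \<in> span B \<Longrightarrow> A x \<in> span B"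
  by (simp add: endo_def)

lemma endo_comp: "endo A \<Longrightarrow> endo C \<Longrightarrow> endo (A \<circ> C)"
  by (auto simp: endo_def linear_compose)

lemma endo_funpow: "endo A \<Longrightarrow> endo (A ^^ n)"
  by (induction n) (auto intro: endo_comp simp: endo_def linear_iff)

lemma adj_pair_comp: "adj_pair A A' \<Longrightarrow> adj_pair C C' \<Longrightarrow> adj_pair (A \<circ> C) (C' \<circ> A')"
  by (auto simp: adj_pair_def endo_comp endo_in)

lemma adj_pair_sym: "adj_pair A A' \<Longrightarrow> adj_pair A' A"
  unfolding adj_pair_def by (metis inner_commute)

lemma adj_pair_id: "adj_pair id id"
  by (auto simp: adj_pair_def endo_def linear_iff)

lemma adj_pair_funpow: "adj_pair A A' \<Longrightarrow> adj_pair (A ^^ n) (A' ^^ n)"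
proof (induction n)
  case 0
  then show ?case using adj_pair_id by (simp add: id_def)
next
  case (Suc n)
  have "adj_pair (A \<circ> A ^^ n) (A' ^^ n \<circ> A')" using Suc by (intro adj_pair_comp) auto
  then show ?case by (simp only: funpow.simps(2)[symmetric] funpow_Suc_right[symmetric])
qed

lemma adj_pairD: "adj_pair A A' \<Longrightarrow> x \<in> span B \<Longrightarrow> y \<in> span B \<Longrightarrow> inner (A x) y = inner x (A' y)"
  by (simp add: adj_pair_def)

lemma adj_pair_endo: "adj_pair A A' \<Longrightarrow> endo A" "adj_pair A A' \<Longrightarrow> endo A'"
  by (auto simp: adj_pair_def)

lemma expand:
  assumes "x \<in> span B"
  shows "x = (\<Sum>b\<in>B. inner x b *\<^sub>R b)"
proof -
  obtain u where u: "x = (\<Sum>b\<in>B. u b *\<^sub>R b)"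
    using assms span_finite[OF finite_B] by auto
  have "inner x c = u c" if "c \<in> B" for c
  proof -
    have "inner x c = (\<Sum>b\<in>B. u b * inner b c)" by (simp add: u inner_sum_left)
    also have "\<dots> = (\<Sum>b\<in>B. if b = c then u b else 0)" using that by (intro sum.cong) (auto simp: inner_B)
    also have "\<dots> = u c" using that finite_B by simp
    finally show ?thesis .
  qed
  then show ?thesis using u by simp
qed

lemma parseval:
  assumes "x \<in> span B"
  shows "inner x y = (\<Sum>b\<in>B. inner x b * inner b y)"
  by (subst expand[OF assms]) (simp add: inner_sum_left)

lemma otrace_comm:
  assumes "endo A" "endo C"
  shows "otrace (A \<circ> C) = otrace (C \<circ> A)"
proof -
  have *: "otrace (A \<circ> C) = (\<Sum>b\<in>B. \<Sum>c\<in>B. inner (C b) c * inner (A c) b)"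
    if "endo A" "endo C" for A C
    unfolding otrace_def
  proof (intro sum.cong refl)
    fix b assume "b \<in> B"
    then have "C b \<in> span B" using that by (simp add: endo_in span_base)
    then have "A (C b) = A (\<Sum>c\<in>B. inner (C b) c *\<^sub>R c)" by (rule arg_cong[OF expand])
    also have "\<dots> = (\<Sum>c\<in>B. inner (C b) c *\<^sub>R A c)"
      using that by (simp add: endo_def linear_sum linear_scale)
    finally have "A (C b) = (\<Sum>c\<in>B. inner (C b) c *\<^sub>R A c)" .
    then show "inner ((A \<circ> C) b) b = (\<Sum>c\<in>B. inner (C b) c * inner (A c) b)"
      by (simp add: inner_sum_left)
  qed
  show ?thesis unfolding *[OF assms] *[OF assms(2,1)]
    by (subst sum.swap) (simp add: mult.commute)
qed

lemma otrace_funpow_comm: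
  assumes "endo A" "endo C"
  shows "otrace ((A \<circ> C) ^^ n) = otrace ((C \<circ> A) ^^ n)"
proof (cases n)
  case (Suc q)
  \<comment> \<open>Regrouping the alternating product isolates one factor \<open>A\<close> on the
    left, so that a single cyclic shift suffices.\<close>
  have "(A \<circ> C) ^^ Suc q = A \<circ> ((C \<circ> A) ^^ q \<circ> C)" for q
  proof (induction q)
    case (Suc q)
    have "(A \<circ> C) ^^ Suc (Suc q) = (A \<circ> C) \<circ> (A \<circ> C) ^^ Suc q" by (rule funpow.simps(2))
    then show ?case unfolding Suc by (simp only: funpow.simps comp_assoc)
  qed auto
  then have "otrace ((A \<circ> C) ^^ Suc q) = otrace (((C \<circ> A) ^^ q \<circ> C) \<circ> A)"
    using assms by (metis otrace_comm endo_comp endo_funpow)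
  also have "((C \<circ> A) ^^ q \<circ> C) \<circ> A = (C \<circ> A) ^^ Suc q"
    by (simp add: funpow_Suc_right comp_assoc del: funpow.simps)
  finally show ?thesis unfolding Suc .
qed simp

lemma otrace_adj_self:
  assumes "adj_pair A A'"
  shows "otrace (A' \<circ> A) = (\<Sum>b\<in>B. (norm (A b))\<^sup>2)"
  unfolding otrace_def
proof (rule sum.cong)
  fix b assume "b \<in> B"
  then have b: "b \<in> span B" "A b \<in> span B" using assms by (auto simp: span_base adj_pair_def endo_in)
  show "inner ((A' \<circ> A) b) b = (norm (A b))\<^sup>2"
    using adj_pairD[OF adj_pair_sym[OF assms] b(2,1)] by (simp add: power2_norm_eq_inner)
qed simp

text \<open>This is Cauchy-Schwarz for the Hilbert-Schmidt inner product of \<open>C\<close> and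
  \<open>A'\<close>.\<close>

lemma otrace_cauchy_schwarz:
  assumes "adj_pair A A'" "adj_pair C C'"
  shows "otrace (A \<circ> C) \<le> sqrt (otrace (A \<circ> A')) * sqrt (otrace (C' \<circ> C))"
proof -
  have "otrace (A \<circ> C) = (\<Sum>b\<in>B. inner (C b) (A' b))"
    unfolding otrace_def using assms by (intro sum.cong) (auto simp: adj_pair_def endo_in span_base)
  also have "\<dots> \<le> (\<Sum>b\<in>B. \<bar>norm (C b)\<bar> * \<bar>norm (A' b)\<bar>)"
    by (intro sum_mono) (simp add: norm_cauchy_schwarz)
  also have "\<dots> \<le> L2_set (\<lambda>b. norm (C b)) B * L2_set (\<lambda>b. norm (A' b)) B"
    by (rule L2_set_mult_ineq)
  also have "\<dots> = sqrt (otrace (C' \<circ> C)) * sqrt (otrace (A \<circ> A'))"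
    using otrace_adj_self[OF assms(2)] otrace_adj_self[OF adj_pair_sym[OF assms(1)]]
    by (simp add: L2_set_def)
  finally show ?thesis by (simp add: mult.commute)
qed

lemma otrace_adj_nonneg: "adj_pair A A' \<Longrightarrow> 0 \<le> otrace (A' \<circ> A)"
  by (simp add: otrace_adj_self sum_nonneg)

text \<open>Simultaneous induction: each inequality for \<open>Suc n\<close> uses both for \<open>n\<close>.\<close>
lemma otrace_pow_ineqs:
  shows "adj_pair M M' \<Longrightarrow> otrace (M ^^ (2 ^ Suc n)) \<le> otrace ((M \<circ> M') ^^ (2 ^ n))"
    and "adj_pair A A \<Longrightarrow> adj_pair C C \<Longrightarrow> otrace ((A \<circ> C) ^^ (2 ^ n)) \<le> otrace (A ^^ (2 ^ n) \<circ> C ^^ (2 ^ n))"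
proof (induction n arbitrary: M M' A C)
  case 0
  {
    case 1
    have "otrace (M \<circ> M) \<le> sqrt (otrace (M \<circ> M')) * sqrt (otrace (M' \<circ> M))"
      using 1 by (intro otrace_cauchy_schwarz)
    also have "otrace (M' \<circ> M) = otrace (M \<circ> M')" using 1 by (simp add: otrace_comm adj_pair_endo)
    also have "sqrt (otrace (M \<circ> M')) * sqrt (otrace (M \<circ> M')) = otrace (M \<circ> M')"
      using otrace_adj_nonneg[OF adj_pair_sym[OF 1]] by simp
    finally show ?case by (simp add: numeral_2_eq_2 comp_def)
  next
    case 2
    then show ?case by simp
  }
next
  case (Suc n)
  note a = Suc.IH(1) and b = Suc.IH(2)
  have dbl: "f ^^ (2 ^ Suc n) = (f \<circ> f) ^^ (2 ^ n)" for f :: "'a \<Rightarrow> 'a" and n :: nat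
    using funpow_mult[of "2 ^ n" 2 f] by (simp add: numeral_2_eq_2 comp_def mult.commute)
  {
    case 1
    \<comment> \<open>A cyclic shift turns \<open>M M M' M'\<close> into the product of the
      self-adjoint operators \<open>Q\<close> and \<open>P\<close>, to which the second inequality
      applies. Cauchy-Schwarz then separates them, and both roots agree because powers of
      \<open>M M'\<close> and of \<open>M' M\<close> have equal traces.\<close>
    define P where "P = M' \<circ> M"
    define Q where "Q = M \<circ> M'"
    have P: "adj_pair P P" and Q: "adj_pair Q Q" unfolding P_def Q_def
      using adj_pair_comp[OF adj_pair_sym[OF 1] 1] adj_pair_comp[OF 1 adj_pair_sym[OF 1]] by auto
    let ?q = "2 ^ n :: nat"
    have "otrace (M ^^ 2 ^ Suc (Suc n)) = otrace ((M \<circ> M) ^^ 2 ^ Suc n)" by (simp only: dbl)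
    also have "\<dots> \<le> otrace (((M \<circ> M) \<circ> (M' \<circ> M')) ^^ ?q)"
      by (rule a) (rule adj_pair_comp[OF 1 1])
    also have "(M \<circ> M) \<circ> (M' \<circ> M') = M \<circ> (M \<circ> (M' \<circ> M'))" by (simp add: comp_assoc)
    also have "otrace ((M \<circ> (M \<circ> (M' \<circ> M'))) ^^ ?q) = otrace (((M \<circ> (M' \<circ> M')) \<circ> M) ^^ ?q)"
      by (rule otrace_funpow_comm) (use 1 in \<open>auto intro!: endo_comp simp: adj_pair_endo\<close>)
    also have "(M \<circ> (M' \<circ> M')) \<circ> M = Q \<circ> P" by (simp add: P_def Q_def comp_assoc)
    also have "otrace ((Q \<circ> P) ^^ ?q) \<le> otrace (Q ^^ ?q \<circ> P ^^ ?q)" by (rule b[OF Q P])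
    also have "\<dots> \<le> sqrt (otrace (Q ^^ ?q \<circ> Q ^^ ?q)) * sqrt (otrace (P ^^ ?q \<circ> P ^^ ?q))"
      using P Q by (intro otrace_cauchy_schwarz adj_pair_funpow)
    also have "Q ^^ ?q \<circ> Q ^^ ?q = Q ^^ (2 ^ Suc n)" by (simp add: mult_2 funpow_add)
    also have "P ^^ ?q \<circ> P ^^ ?q = P ^^ (2 ^ Suc n)" by (simp add: mult_2 funpow_add)
    also have "otrace (P ^^ (2 ^ Suc n)) = otrace (Q ^^ (2 ^ Suc n))"
      unfolding P_def Q_def using 1 by (intro otrace_funpow_comm) (auto simp: adj_pair_endo)
    also have "sqrt (otrace (Q ^^ (2 ^ Suc n))) * sqrt (otrace (Q ^^ (2 ^ Suc n))) = otrace (Q ^^ (2 ^ Suc n))"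
      using otrace_adj_nonneg[OF adj_pair_funpow[OF Q, of ?q]]
      by (simp add: mult_2 funpow_add)
    finally show ?case unfolding Q_def .
  next
    case (2 A C)
    have "otrace ((A \<circ> C) ^^ 2 ^ Suc n) \<le> otrace (((A \<circ> C) \<circ> (C \<circ> A)) ^^ (2 ^ n))"
      by (rule a) (rule adj_pair_comp[OF 2])
    \<comment> \<open>\<open>A C C A\<close> is a cyclic shift of the product of the squares of
      \<open>C\<close> and \<open>A\<close>, again two self-adjoint operators; the reversed order is
      undone at the end by cyclicity.\<close>
    also have "(A \<circ> C) \<circ> (C \<circ> A) = A \<circ> (C \<circ> C \<circ> A)" by (simp add: comp_assoc)
    also have "otrace ((A \<circ> (C \<circ> C \<circ> A)) ^^ (2 ^ n)) = otrace (((C \<circ> C \<circ> A) \<circ> A) ^^ (2 ^ n))"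
      by (rule otrace_funpow_comm) (use 2 in \<open>auto intro!: endo_comp simp: adj_pair_endo\<close>)
    also have "(C \<circ> C \<circ> A) \<circ> A = (C \<circ> C) \<circ> (A \<circ> A)" by (simp add: comp_assoc)
    also have "otrace (((C \<circ> C) \<circ> (A \<circ> A)) ^^ (2 ^ n)) \<le> otrace ((C \<circ> C) ^^ (2 ^ n) \<circ> (A \<circ> A) ^^ (2 ^ n))"
      using 2 by (intro b adj_pair_comp)
    also have "\<dots> = otrace (C ^^ (2 ^ Suc n) \<circ> A ^^ (2 ^ Suc n))" by (simp only: dbl)
    also have "\<dots> = otrace (A ^^ (2 ^ Suc n) \<circ> C ^^ (2 ^ Suc n))"
      using 2 by (intro otrace_comm endo_funpow) (auto simp: adj_pair_endo)
    finally show ?case .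
  }
qed

text \<open>\<open>euler_step N A ^^ N\<close> is Euler's approximation \<open>(1 + A / N)\<^sup>N\<close> of \<open>exp A\<close>.\<close>
definition euler_step :: "nat \<Rightarrow> ('a \<Rightarrow> 'a) \<Rightarrow> 'a \<Rightarrow> 'a" where
  "euler_step N A = (\<lambda>x. x + (1 / real N) *\<^sub>R A x)"

section \<open>Euler's approximation: Golden-Thompson, a quadratic bound, and tails\<close>

lemma adj_pair_add: "adj_pair A A' \<Longrightarrow> adj_pair C C' \<Longrightarrow> adj_pair (\<lambda>x. A x + C x) (\<lambda>x. A' x + C' x)"
  by (auto simp: adj_pair_def endo_def span_add inner_simps linear_compose_add)

lemma adj_pair_zero: "adj_pair (\<lambda>x. 0) (\<lambda>x. 0)"
  by (auto simp: adj_pair_def endo_def linear_iff span_zero)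

lemma adj_pair_sum: "(\<And>i. i \<in> I \<Longrightarrow> adj_pair (A i) (A' i)) \<Longrightarrow> adj_pair (\<lambda>x. \<Sum>i\<in>I. A i x) (\<lambda>x. \<Sum>i\<in>I. A' i x)"
  by (induction I rule: infinite_finite_induct) (auto intro: adj_pair_add adj_pair_zero)

lemma adj_pair_euler_step: "adj_pair A A' \<Longrightarrow> adj_pair (euler_step N A) (euler_step N A')"
  by (auto simp: adj_pair_def endo_def euler_step_def linear_iff span_add span_scale inner_simps algebra_simps)

lemma norm_boundD: "norm_bound A c \<Longrightarrow> x \<in> span B \<Longrightarrow> norm (A x) \<le> c * norm x"
  by (simp add: norm_bound_def)

lemma norm_bound_sum:
  assumes "\<And>i. i \<in> I \<Longrightarrow> norm_bound (A i) c" "finite I"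
  shows "norm_bound (\<lambda>x. \<Sum>i\<in>I. A i x) (card I * c)"
  unfolding norm_bound_def
proof
  fix x assume "x \<in> span B"
  have "norm (\<Sum>i\<in>I. A i x) \<le> (\<Sum>i\<in>I. c * norm x)"
    using assms \<open>x \<in> span B\<close> by (intro sum_norm_le) (auto simp: norm_bound_def)
  then show "norm (\<Sum>i\<in>I. A i x) \<le> card I * c * norm x" by simp
qed

lemma norm_bound_comp: "endo C \<Longrightarrow> norm_bound A a \<Longrightarrow> norm_bound C c \<Longrightarrow> 0 \<le> a \<Longrightarrow> norm_bound (A \<circ> C) (a * c)"
  unfolding norm_bound_def
proof
  fix x assume C: "endo C" "\<forall>x\<in>span B. norm (C x) \<le> c * norm x" "\<forall>x\<in>span B. norm (A x) \<le> a * norm x"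
    and "0 \<le> a" and x: "x \<in> span B"
  have "norm (A (C x)) \<le> a * norm (C x)" using C(3) endo_in[OF C(1) x] by blast
  also have "\<dots> \<le> a * (c * norm x)" using C(2) x \<open>0 \<le> a\<close> by (intro mult_left_mono) auto
  finally show "norm ((A \<circ> C) x) \<le> a * c * norm x" by simp
qed

lemma norm_bound_funpow: "endo A \<Longrightarrow> norm_bound A a \<Longrightarrow> 0 \<le> a \<Longrightarrow> norm_bound (A ^^ n) (a ^ n)"
proof (induction n)
  case (Suc n)
  then show ?case unfolding funpow.simps(2) power_Suc by (intro norm_bound_comp endo_funpow) auto
qed (simp add: norm_bound_def)

lemma norm_bound_mono: "norm_bound A a \<Longrightarrow> a \<le> a' \<Longrightarrow> norm_bound A a'"
  unfolding norm_bound_def by (meson mult_right_mono norm_ge_zero order_trans)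

lemma norm_B: "b \<in> B \<Longrightarrow> norm b = 1"
  by (simp add: norm_eq_sqrt_inner inner_B)

lemma otrace_le:
  assumes "norm_bound A c"
  shows "otrace A \<le> real (card B) * c"
proof -
  have "otrace A \<le> (\<Sum>b\<in>B. c :: real)" unfolding otrace_def
  proof (rule sum_mono)
    fix b assume b: "b \<in> B"
    have "inner (A b) b \<le> norm (A b) * norm b" by (rule norm_cauchy_schwarz)
    also have "\<dots> \<le> c" using norm_boundD[OF assms span_base[OF b]] norm_B[OF b] by simp
    finally show "inner (A b) b \<le> c" .
  qed
  then show ?thesis by simp
qed

lemma otrace_diff: "otrace (\<lambda>x. A x - C x) = otrace A - otrace C"
  by (simp add: otrace_def inner_diff_left sum_subtractf)

text \<open>Telescoping, in the form \<open>P^(n+1) - Q^(n+1) = P (P^n - Q^n) + (P - Q) Q^n\<close>.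
  Since \<open>1 \<le> c\<close>, every term may be charged with the full power
  \<open>c ^ n\<close>.\<close>

lemma norm_bound_funpow_diff:
  assumes "endo P" "endo Q" "norm_bound P c" "norm_bound Q c" "norm_bound (\<lambda>x. P x - Q x) e" "1 \<le> c" "0 \<le> e"
  shows "norm_bound (\<lambda>x. (P ^^ n) x - (Q ^^ n) x) (n * c ^ n * e)"
proof (induction n)
  case (Suc n)
  show ?case unfolding norm_bound_def
  proof
    fix x assume x: "x \<in> span B"
    have in_span: "(P ^^ n) x \<in> span B" "(Q ^^ n) x \<in> span B"
      using x assms endo_funpow endo_in by blast+
    have "(P ^^ Suc n) x - (Q ^^ Suc n) x
        = P ((P ^^ n) x - (Q ^^ n) x) + (P ((Q ^^ n) x) - Q ((Q ^^ n) x))"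
      using assms(1) by (simp add: endo_def linear_diff)
    also have "norm \<dots> \<le> norm (P ((P ^^ n) x - (Q ^^ n) x)) + norm (P ((Q ^^ n) x) - Q ((Q ^^ n) x))"
      by (rule norm_triangle_ineq)
    also have "\<dots> \<le> c * norm ((P ^^ n) x - (Q ^^ n) x) + e * norm ((Q ^^ n) x)"
      using norm_boundD[OF assms(3) span_diff[OF in_span]] norm_boundD[OF assms(5) in_span(2)] by (rule add_mono)
    also have "\<dots> \<le> c * (n * c ^ n * e * norm x) + e * (c ^ n * norm x)"
    proof (intro add_mono mult_left_mono)
      show "norm ((P ^^ n) x - (Q ^^ n) x) \<le> n * c ^ n * e * norm x" using norm_boundD[OF Suc x] .
      show "norm ((Q ^^ n) x) \<le> c ^ n * norm x"
        using norm_boundD[OF norm_bound_funpow[OF assms(2,4)] x] assms by simp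
    qed (use assms in auto)
    also have "\<dots> \<le> c * (n * c ^ n * e * norm x) + e * ((c * c ^ n) * norm x)"
      using assms mult_right_mono[of 1 c "c ^ n"] by (intro add_mono mult_left_mono mult_right_mono) auto
    also have "\<dots> = Suc n * c ^ Suc n * e * norm x" by (simp add: algebra_simps)
    finally show "norm ((P ^^ Suc n) x - (Q ^^ Suc n) x) \<le> Suc n * c ^ Suc n * e * norm x" .
  qed
qed (simp add: norm_bound_def)

lemma norm_bound_euler_step:
  assumes "norm_bound A a"
  shows "norm_bound (euler_step N A) (1 + a / N)"
  unfolding norm_bound_def
proof
  fix x assume x: "x \<in> span B"
  have "norm (euler_step N A x) \<le> norm x + norm ((1 / N) *\<^sub>R A x)" unfolding euler_step_def by (rule norm_triangle_ineq)
  also have "\<dots> \<le> norm x + (1 / N) * (a * norm x)"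
    using norm_boundD[OF assms x] by (simp add: divide_right_mono)
  finally show "norm (euler_step N A x) \<le> (1 + a / N) * norm x" by (simp add: algebra_simps)
qed

text \<open>One step for the sum and the product of the two steps differ only by
  \<open>A X / N^2\<close>. Over \<open>N\<close> factors this accumulates to order
  \<open>1 / N\<close>, and the trace inequality for powers of two separates the product.\<close>

lemma golden_thompson_euler_step:
  assumes A: "adj_pair A A" "norm_bound A a" "0 \<le> a" and X: "adj_pair X X" "norm_bound X x" "0 \<le> x" and N: "N = 2 ^ n"
  shows "otrace (euler_step N (\<lambda>v. A v + X v) ^^ N)
    \<le> otrace (euler_step N A ^^ N \<circ> euler_step N X ^^ N) + card B * (a * x * exp (a + x)) / N"
proof -
  define P where "P = euler_step N (\<lambda>v. A v + X v)"
  define Q where "Q = euler_step N A \<circ> euler_step N X"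
  \<comment> \<open>A common bound for \<open>P\<close> and \<open>Q\<close>, from
    \<open>1 + y \<le> exp y\<close>; its \<open>N\<close>-th power is \<open>exp (a + x)\<close>,
    independent of \<open>N\<close>.\<close>
  define c where "c = exp ((a + x) / N)"
  define e where "e = a * x / (real N)\<^sup>2"
  have N0: "N > 0" using N by simp
  have eP: "endo P" and eQ: "endo Q"
    unfolding P_def Q_def
    by (rule adj_pair_endo(1)[OF adj_pair_euler_step[OF adj_pair_add[OF A(1) X(1)]]],
        rule adj_pair_endo(1)[OF adj_pair_comp[OF adj_pair_euler_step[OF A(1)] adj_pair_euler_step[OF X(1)]]])
  have AX: "norm_bound (\<lambda>v. A v + X v) (a + x)" unfolding norm_bound_def
    using norm_boundD[OF A(2)] norm_boundD[OF X(2)] by (auto intro!: order_trans[OF norm_triangle_ineq] add_mono simp: distrib_right)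
  have "norm_bound P (1 + (a + x) / N)" unfolding P_def by (rule norm_bound_euler_step[OF AX])
  then have bP: "norm_bound P c" by (rule norm_bound_mono) (simp add: c_def)
  have "norm_bound Q ((1 + a / N) * (1 + x / N))" unfolding Q_def
    using A X by (intro norm_bound_comp norm_bound_euler_step adj_pair_endo(1)[OF adj_pair_euler_step[OF X(1)]]) auto
  moreover have "(1 + a / N) * (1 + x / N) \<le> exp (a / N) * exp (x / N)"
    using A X by (intro mult_mono) auto
  ultimately have bQ: "norm_bound Q c" by (elim norm_bound_mono) (simp add: c_def exp_add[symmetric] add_divide_distrib)
  have bPQ: "norm_bound (\<lambda>v. P v - Q v) e" unfolding norm_bound_def
  proof
    fix v assume v: "v \<in> span B"
    have Xv: "X v \<in> span B" using v X by (auto simp: adj_pair_def endo_in)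
    have lin: "linear A" using A by (simp add: adj_pair_def endo_def)
    have "P v - Q v = - ((1 / (real N)\<^sup>2) *\<^sub>R A (X v))"
      by (simp add: P_def Q_def euler_step_def linear_add[OF lin] linear_scale[OF lin] scaleR_add_right power2_eq_square)
    then have "norm (P v - Q v) = (1 / (real N)\<^sup>2) * norm (A (X v))" by simp
    also have "\<dots> \<le> (1 / (real N)\<^sup>2) * (a * (x * norm v))"
      using norm_boundD[OF A(2) Xv] norm_boundD[OF X(2) v] A(3)
      by (intro mult_left_mono) (auto intro: order_trans mult_left_mono)
    finally show "norm (P v - Q v) \<le> e * norm v" by (simp add: e_def)
  qed
  have "otrace (\<lambda>v. (P ^^ N) v - (Q ^^ N) v) \<le> card B * (N * c ^ N * e)"
    by (intro otrace_le norm_bound_funpow_diff eP eQ bP bQ bPQ) (use A X in \<open>auto simp: c_def e_def\<close>)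
  also have "N * c ^ N * e = a * x * exp (a + x) / N"
    using N0 by (simp add: c_def e_def exp_of_nat_mult[symmetric] power2_eq_square)
  finally have "otrace (P ^^ N) \<le> otrace (Q ^^ N) + card B * (a * x * exp (a + x)) / N"
    by (simp add: otrace_diff)
  also have "otrace (Q ^^ N) \<le> otrace (euler_step N A ^^ N \<circ> euler_step N X ^^ N)"
    unfolding Q_def N by (rule otrace_pow_ineqs) (use A X in \<open>auto intro: adj_pair_euler_step\<close>)
  finally show ?thesis by (simp add: P_def)
qed

text \<open>The remainder is kept as \<open>X Q X\<close>, with a factor \<open>X\<close> on each
  side: by self-adjointness its quadratic form is then controlled by the squared norm of
  \<open>X v\<close>, although \<open>Q\<close> is known only through a norm bound.\<close>

lemma euler_step_funpow_expand:
  assumes X: "adj_pair X X" "norm_bound X 1" and "k \<le> N" "N > 0"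
  shows "\<exists>Q. \<forall>v\<in>span B. Q v \<in> span B \<and> norm (Q v) \<le> (real k)\<^sup>2 * norm v \<and>
    (euler_step N X ^^ k) v = v + (k / N) *\<^sub>R X v + (1 / (real N)\<^sup>2) *\<^sub>R X (Q (X v))"
  using \<open>k \<le> N\<close>
proof (induction k)
  case 0
  have "X 0 = 0" using X by (auto simp: adj_pair_def endo_def linear_0)
  then show ?case by (intro exI[of _ "\<lambda>_. 0"]) (auto simp: span_zero)
next
  case (Suc k)
  from Suc.IH[OF Suc_leD[OF Suc.prems]] obtain Q where Q0: "\<forall>v\<in>span B. Q v \<in> span B \<and> norm (Q v) \<le> (real k)\<^sup>2 * norm v \<and>
      (euler_step N X ^^ k) v = v + (k / N) *\<^sub>R X v + (1 / (real N)\<^sup>2) *\<^sub>R X (Q (X v))"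
    by (elim exE)
  note Q = Q0[rule_format, THEN conjunct1] Q0[rule_format, THEN conjunct2, THEN conjunct1]
    Q0[rule_format, THEN conjunct2, THEN conjunct2]
  have lin: "linear X" and inX: "\<And>v. v \<in> span B \<Longrightarrow> X v \<in> span B"
    using X by (auto simp: adj_pair_def endo_def)
  \<comment> \<open>Read off by multiplying the expansion with \<open>1 + X / N\<close>: the term
    \<open>(k / N) X\<close> contributes \<open>k\<close>, and the old remainder contributes
    \<open>Q + X Q / N\<close>.\<close>
  define Q' where "Q' u = real k *\<^sub>R u + Q u + (1 / N) *\<^sub>R X (Q u)" for u
  have "Q' v \<in> span B \<and> norm (Q' v) \<le> (real (Suc k))\<^sup>2 * norm v \<and>
     (euler_step N X ^^ Suc k) v = v + (Suc k / N) *\<^sub>R X v + (1 / (real N)\<^sup>2) *\<^sub>R X (Q' (X v))"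
    if v: "v \<in> span B" for v
  proof (intro conjI)
    show "Q' v \<in> span B" unfolding Q'_def using v Q inX by (intro span_add span_scale) auto
    have "norm (Q' v) \<le> norm (real k *\<^sub>R v) + norm (Q v) + norm ((1 / N) *\<^sub>R X (Q v))"
      unfolding Q'_def by (intro order_trans[OF norm_triangle_ineq] add_mono order_refl norm_triangle_ineq)
    also have "\<dots> \<le> real k * norm v + (real k)\<^sup>2 * norm v + (1 / N) * ((real k)\<^sup>2 * norm v)"
      using norm_boundD[OF X(2) Q(1)[OF v]] Q(2)[OF v]
      by (intro add_mono) (auto intro!: divide_right_mono)
    also have "\<dots> = (real k + (real k)\<^sup>2 + (real k)\<^sup>2 / N) * norm v" by (simp add: algebra_simps)
    also have "\<dots> \<le> (real (Suc k))\<^sup>2 * norm v"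
    proof (intro mult_right_mono)
      \<comment> \<open>Here \<open>k \<le> N\<close> enters: the sum is at most
        \<open>k^2 + 2 k\<close>, which fits below \<open>(k + 1)^2\<close>.\<close>
      have "(real k)\<^sup>2 / N \<le> k"
        using Suc.prems \<open>N > 0\<close> by (simp add: divide_le_eq power2_eq_square mult_left_mono)
      then show "real k + (real k)\<^sup>2 + (real k)\<^sup>2 / N \<le> (real (Suc k))\<^sup>2"
        by (simp add: power2_eq_square algebra_simps)
    qed simp
    finally show "norm (Q' v) \<le> (real (Suc k))\<^sup>2 * norm v" .
    have "(euler_step N X ^^ Suc k) v = euler_step N X (v + (k / N) *\<^sub>R X v + (1 / (real N)\<^sup>2) *\<^sub>R X (Q (X v)))"
      using Q(3)[OF v] by simp
    also have "\<dots> = v + (Suc k / N) *\<^sub>R X v + (1 / (real N)\<^sup>2) *\<^sub>R X (Q' (X v))"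
      by (simp add: euler_step_def Q'_def linear_add[OF lin] linear_scale[OF lin] algebra_simps add_divide_distrib power2_eq_square)
    finally show "(euler_step N X ^^ Suc k) v = v + (Suc k / N) *\<^sub>R X v + (1 / (real N)\<^sup>2) *\<^sub>R X (Q' (X v))" .
  qed
  then show ?case by (intro exI[of _ Q'] ballI)
qed

text \<open>The finite counterpart of \<open>exp X \<le> 1 + X + X^2\<close> for self-adjoint
  \<open>X\<close> of norm at most one. At exponent \<open>N\<close> the bound \<open>N^2\<close> on
  the inner factor of the remainder cancels the prefactor \<open>1 / N^2\<close>.\<close>

lemma euler_step_quadratic_bound:
  assumes X: "adj_pair X X" "norm_bound X 1" and "N > 0" and v: "v \<in> span B"
  shows "inner ((euler_step N X ^^ N) v) v \<le> (norm v)\<^sup>2 + (inner (X v) v + (norm (X v))\<^sup>2)"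
proof -
  obtain Q where Q: "\<And>v. v \<in> span B \<Longrightarrow> Q v \<in> span B"
      "\<And>v. v \<in> span B \<Longrightarrow> norm (Q v) \<le> (real N)\<^sup>2 * norm v"
      "(euler_step N X ^^ N) v = v + (N / N) *\<^sub>R X v + (1 / (real N)\<^sup>2) *\<^sub>R X (Q (X v))"
    using euler_step_funpow_expand[OF X order_refl \<open>N > 0\<close>] v by auto
  have Xv: "X v \<in> span B" using X v by (auto simp: adj_pair_def endo_in)
  have "inner (X (Q (X v))) v = inner (Q (X v)) (X v)" using adj_pairD[OF X(1) Q(1)[OF Xv] v] .
  also have "\<dots> \<le> norm (Q (X v)) * norm (X v)" by (rule norm_cauchy_schwarz)
  also have "\<dots> \<le> ((real N)\<^sup>2 * norm (X v)) * norm (X v)" by (intro mult_right_mono Q Xv) simp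
  finally have "(1 / (real N)\<^sup>2) * inner (X (Q (X v))) v \<le> (norm (X v))\<^sup>2"
    using \<open>N > 0\<close> by (simp add: divide_le_eq power2_eq_square mult_ac)
  then show ?thesis unfolding Q(3) using \<open>N > 0\<close>
    by (simp add: inner_add_left power2_norm_eq_inner)
qed

text \<open>Repeated squaring: by Cauchy-Schwarz the square of
  \<open>\<langle>H^q v, v\<rangle>\<close> is at most the squared norm of \<open>H^q v\<close>,
  which is \<open>\<langle>H^(2q) v, v\<rangle>\<close>. This takes the place of Jensen's inequality
  for the spectral measure of \<open>v\<close>.\<close>

lemma pow_jensen:
  assumes H: "adj_pair H H" and v: "v \<in> span B" "norm v = 1" "0 \<le> inner (H v) v"
  shows "(inner (H v) v) ^ (2 ^ n) \<le> inner ((H ^^ (2 ^ n)) v) v"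
proof (induction n)
  case (Suc n)
  let ?q = "2 ^ n :: nat"
  have q: "2 ^ Suc n = ?q + ?q" by simp
  have "(inner (H v) v) ^ (2 ^ Suc n) = ((inner (H v) v) ^ ?q)\<^sup>2"
    by (simp add: power_mult[symmetric] mult.commute)
  also have "\<dots> \<le> (inner ((H ^^ ?q) v) v)\<^sup>2" using v Suc by (intro power_mono) auto
  also have "\<dots> \<le> (norm ((H ^^ ?q) v) * norm v)\<^sup>2"
    using power_mono[OF Cauchy_Schwarz_ineq2[of "(H ^^ ?q) v" v], of 2] by simp
  also have "\<dots> = inner ((H ^^ ?q) v) ((H ^^ ?q) v)" using v by (simp add: power2_norm_eq_inner)
  also have "\<dots> = inner ((H ^^ ?q) ((H ^^ ?q) v)) v"
    using adj_pairD[OF adj_pair_funpow[OF H, of ?q] endo_in[OF endo_funpow[OF adj_pair_endo(1)[OF H], of ?q] v(1)] v(1)] by simp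
  also have "\<dots> = inner ((H ^^ (2 ^ Suc n)) v) v" unfolding q by (simp add: funpow_add)
  finally show ?case .
qed simp

text \<open>The right-hand side is the squared Hilbert-Schmidt norm of \<open>K\<close>, which
  dominates the operator norm.\<close>

lemma norm_le_otrace:
  assumes K: "adj_pair K K'" and v: "v \<in> span B" "norm v = 1"
  shows "(norm (K v))\<^sup>2 \<le> otrace (K' \<circ> K)"
proof -
  have lin: "linear K" using K by (simp add: adj_pair_def endo_def)
  have "norm (K v) = norm (\<Sum>b\<in>B. inner v b *\<^sub>R K b)"
    by (subst expand[OF v(1)]) (simp add: linear_sum[OF lin] linear_scale[OF lin])
  also have "\<dots> \<le> (\<Sum>b\<in>B. \<bar>inner v b\<bar> * \<bar>norm (K b)\<bar>)"
    by (rule sum_norm_le) simp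
  also have "\<dots> \<le> L2_set (\<lambda>b. inner v b) B * L2_set (\<lambda>b. norm (K b)) B" by (rule L2_set_mult_ineq)
  also have "L2_set (\<lambda>b. inner v b) B = norm v"
    unfolding L2_set_def norm_eq_sqrt_inner using parseval[OF v(1), of v]
    by (simp add: power2_eq_square inner_commute)
  also have "norm v * L2_set (\<lambda>b. norm (K b)) B = sqrt (otrace (K' \<circ> K))"
    using v by (simp add: L2_set_def otrace_adj_self[OF K])
  finally show ?thesis
    using otrace_adj_nonneg[OF K] by (metis norm_ge_zero power_mono real_sqrt_pow2)
qed

text \<open>The deterministic half of the Chernoff bound. As the exponent is even, the power is
  \<open>K \<circ> K\<close> with \<open>K\<close> self-adjoint, so its quadratic form at
  \<open>v\<close> is a squared norm and lies below the trace, whatever the sign of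
  \<open>1 + S / N\<close>.\<close>

lemma tail_le_otrace:
  assumes S: "adj_pair S S" and v: "v \<in> span B" "norm v = 1" and t: "0 \<le> t" "t \<le> inner (S v) v"
  shows "(1 + t / real (2 ^ Suc n)) ^ (2 ^ Suc n) \<le> otrace (euler_step (2 ^ Suc n) S ^^ (2 ^ Suc n))"
proof -
  let ?N = "2 ^ Suc n :: nat"
  let ?H = "euler_step ?N S"
  have H: "adj_pair ?H ?H" by (rule adj_pair_euler_step[OF S])
  let ?K = "?H ^^ (2 ^ n)"
  have K: "adj_pair ?K ?K" by (rule adj_pair_funpow[OF H])
  have KK: "?H ^^ ?N = ?K \<circ> ?K" by (simp add: mult_2 funpow_add)
  have i: "inner (?H v) v = 1 + inner (S v) v / ?N"
    using v by (simp add: euler_step_def inner_add_left power2_norm_eq_inner[symmetric])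
  have "(1 + t / real ?N) ^ ?N \<le> (inner (?H v) v) ^ ?N"
    using t unfolding i by (intro power_mono add_left_mono divide_right_mono) auto
  also have "\<dots> \<le> inner ((?H ^^ ?N) v) v"
    using t by (intro pow_jensen H v) (simp only: i, simp)
  also have "\<dots> = inner (?K v) (?K v)" unfolding KK
    using adj_pairD[OF K endo_in[OF adj_pair_endo(1)[OF K] v(1)] v(1)] by simp
  also have "\<dots> \<le> otrace (?K \<circ> ?K)" using norm_le_otrace[OF K v] by (simp add: power2_norm_eq_inner)
  finally show ?thesis by (simp only: KK)
qed

end

section \<open>Tail bound for sums of random self-adjoint operators\<close>

context onb
begin

lemma moment_integrable:
  fixes p :: "'j pmf"
  assumes norm_bound_Z: "\<And>j. norm_bound (Z j) 1" and v: "v \<in> span B"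
  shows "integrable (measure_pmf p) (\<lambda>j. inner (Z j v) v + (norm (Z j v))\<^sup>2)"
proof (rule measure_pmf.integrable_const_bound)
  have *: "\<bar>inner (Z j v) v + (norm (Z j v))\<^sup>2\<bar> \<le> 2 * (norm v)\<^sup>2" for j
  proof -
    have n: "norm (Z j v) \<le> norm v" using norm_boundD[OF norm_bound_Z v] by simp
    have "\<bar>inner (Z j v) v\<bar> \<le> norm (Z j v) * norm v" by (rule Cauchy_Schwarz_ineq2)
    also have "\<dots> \<le> norm v * norm v" using n by (rule mult_right_mono) simp
    finally show ?thesis using power_mono[OF n norm_ge_zero, of 2] zero_le_power2[of "norm (Z j v)"]
      unfolding abs_le_iff power2_eq_square by (simp; linarith)
  qed
  then show "AE j in measure_pmf p. norm (inner (Z j v) v + (norm (Z j v))\<^sup>2) \<le> 2 * (norm v)\<^sup>2"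
    by simp
qed simp

context
  fixes p :: "'j pmf" and Z :: "'j \<Rightarrow> 'a \<Rightarrow> 'a" and \<sigma> :: real
  assumes adj_pair_Z: "\<And>j. adj_pair (Z j) (Z j)"
    and norm_bound_Z: "\<And>j. norm_bound (Z j) 1"
    and \<sigma>_nonneg: "0 \<le> \<sigma>"
    and moment: "\<And>v. v \<in> span B \<Longrightarrow>
      measure_pmf.expectation p (\<lambda>j. inner (Z j v) v + (norm (Z j v))\<^sup>2) \<le> \<sigma> * (norm v)\<^sup>2"
begin

text \<open>Averaging over one new summand costs a factor \<open>1 + \<sigma>\<close> and an error
  of order \<open>1 / N\<close>. The assumption \<open>moment\<close> bounds exactly the form
  \<open>Z + Z^2\<close> that the quadratic bound produces, and it is applied at the vectors
  \<open>H b\<close>.\<close>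

lemma nn_integral_otrace_step:
  assumes S: "adj_pair S S" "norm_bound S a" "0 \<le> a" and N: "N = 2 ^ Suc n"
  shows "(\<integral>\<^sup>+ y. ennreal (otrace (euler_step N (\<lambda>v. S v + Z y v) ^^ N)) \<partial>measure_pmf p)
    \<le> ennreal (1 + \<sigma>) * ennreal (otrace (euler_step N S ^^ N)) + ennreal (card B * (a * exp (a + 1)) / N)"
proof -
  \<comment> \<open>Half of the power goes on each side of the random factor, which makes the trace
    a sum of quadratic forms of that factor. \<open>N\<close> is even for this purpose.\<close>
  define H where "H = euler_step N S ^^ (2 ^ n)"
  define C where "C = card B * (a * exp (a + 1)) / N"
  have H: "adj_pair H H" unfolding H_def by (intro adj_pair_funpow adj_pair_euler_step S)
  have HH: "euler_step N S ^^ N = H \<circ> H" by (simp add: H_def N mult_2 funpow_add)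
  have Hb: "H b \<in> span B" if "b \<in> B" for b using that H by (auto simp: adj_pair_def endo_in span_base)
  have C0: "0 \<le> C" using S by (simp add: C_def)
  define u where "u y = (\<Sum>b\<in>B. (norm (H b))\<^sup>2 + (inner (Z y (H b)) (H b) + (norm (Z y (H b)))\<^sup>2)) + C" for y
  have N0: "N > 0" using N by simp
  have le: "otrace (euler_step N (\<lambda>v. S v + Z y v) ^^ N) \<le> u y" for y
  proof -
    let ?M = "euler_step N (Z y) ^^ N"
    have M: "adj_pair ?M ?M" by (intro adj_pair_funpow adj_pair_euler_step adj_pair_Z)
    have "otrace (euler_step N (\<lambda>v. S v + Z y v) ^^ N) \<le> otrace (euler_step N S ^^ N \<circ> ?M) + C"
      using golden_thompson_euler_step[OF S adj_pair_Z norm_bound_Z, of N "Suc n"] N by (simp add: C_def)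
    also have "otrace (euler_step N S ^^ N \<circ> ?M) = otrace (H \<circ> (H \<circ> ?M))" by (simp add: HH comp_assoc)
    also have "\<dots> = otrace ((H \<circ> ?M) \<circ> H)"
      using H M by (intro otrace_comm endo_comp) (auto simp: adj_pair_def)
    also have "\<dots> = (\<Sum>b\<in>B. inner (?M (H b)) (H b))" unfolding otrace_def
    proof (intro sum.cong refl)
      fix b assume b: "b \<in> B"
      have "?M (H b) \<in> span B" using Hb[OF b] M by (auto simp: adj_pair_def endo_in)
      from adj_pairD[OF H this span_base[OF b]]
      show "inner ((H \<circ> ?M \<circ> H) b) b = inner (?M (H b)) (H b)" by simp
    qed
    also have "\<dots> \<le> (\<Sum>b\<in>B. (norm (H b))\<^sup>2 + (inner (Z y (H b)) (H b) + (norm (Z y (H b)))\<^sup>2))"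
      by (intro sum_mono euler_step_quadratic_bound adj_pair_Z norm_bound_Z N0 Hb)
    finally show ?thesis by (simp add: u_def)
  qed
  have nn: "0 \<le> otrace (euler_step N (\<lambda>v. S v + Z y v) ^^ N)" for y
  proof -
    let ?K = "euler_step N (\<lambda>v. S v + Z y v) ^^ (2 ^ n)"
    have "adj_pair ?K ?K" by (intro adj_pair_funpow adj_pair_euler_step adj_pair_add S adj_pair_Z)
    from otrace_adj_nonneg[OF this] show ?thesis by (simp add: N mult_2 funpow_add)
  qed
  have mi: "integrable (measure_pmf p) (\<lambda>y. inner (Z y (H b)) (H b) + (norm (Z y (H b)))\<^sup>2)"
    if "b \<in> B" for b by (rule moment_integrable[OF norm_bound_Z Hb[OF that]])
  have int: "integrable (measure_pmf p) u"
    unfolding u_def using mi by auto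
  have "(\<integral>\<^sup>+ y. ennreal (otrace (euler_step N (\<lambda>v. S v + Z y v) ^^ N)) \<partial>measure_pmf p)
      \<le> (\<integral>\<^sup>+ y. ennreal (u y) \<partial>measure_pmf p)"
    by (intro nn_integral_mono ennreal_leI le)
  also have "\<dots> = ennreal (measure_pmf.expectation p u)"
    using nn le by (intro nn_integral_eq_integral int) (auto intro: order_trans)
  also have "measure_pmf.expectation p u =
      (\<Sum>b\<in>B. (norm (H b))\<^sup>2 + measure_pmf.expectation p (\<lambda>y. inner (Z y (H b)) (H b) + (norm (Z y (H b)))\<^sup>2)) + C"
    unfolding u_def using mi
    by (simp add: Bochner_Integration.integral_add Bochner_Integration.integral_sum)
  also have "\<dots> \<le> (\<Sum>b\<in>B. (norm (H b))\<^sup>2 + \<sigma> * (norm (H b))\<^sup>2) + C"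
    by (intro add_mono sum_mono moment Hb) auto
  also have "\<dots> = (1 + \<sigma>) * otrace (euler_step N S ^^ N) + C"
    by (simp add: HH otrace_adj_self[OF H] sum_distrib_left algebra_simps sum.distrib)
  finally have "(\<integral>\<^sup>+ y. ennreal (otrace (euler_step N (\<lambda>v. S v + Z y v) ^^ N)) \<partial>measure_pmf p)
      \<le> ennreal ((1 + \<sigma>) * otrace (euler_step N S ^^ N) + C)"
    by (auto intro: ennreal_leI)
  also have "\<dots> = ennreal (1 + \<sigma>) * ennreal (otrace (euler_step N S ^^ N)) + ennreal C"
    using \<sigma>_nonneg C0 otrace_adj_nonneg[OF H] by (simp add: HH ennreal_plus ennreal_mult)
  finally show ?thesis by (simp add: C_def)
qed

text \<open>The order of quantifiers matters: \<open>K\<close> may depend on \<open>I\<close> but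
  not on \<open>n\<close>, so the error vanishes as \<open>n\<close> grows. Nonnegative integrals
  spare an integrability proof for the trace on the product space.\<close>

lemma nn_integral_otrace_sum:
  assumes "finite I"
  shows "\<exists>K\<ge>0. \<forall>n. (\<integral>\<^sup>+ f. ennreal (otrace (euler_step (2 ^ Suc n) (\<lambda>v. \<Sum>i\<in>I. Z (f i) v) ^^ (2 ^ Suc n)))
      \<partial>measure_pmf (Pi_pmf I dflt (\<lambda>_. p))) \<le> ennreal (card B * (1 + \<sigma>) ^ card I + K / 2 ^ Suc n)"
  using assms
proof (induction I rule: finite_induct)
  case empty
  have "euler_step N (\<lambda>v. 0) = id" for N by (auto simp: euler_step_def)
  moreover have "otrace id = card B" by (simp add: otrace_def inner_B)
  moreover have "((\<lambda>x. x) :: 'a \<Rightarrow> 'a) ^^ N = (\<lambda>x. x)" for N by (induction N) auto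
  ultimately show ?case by (intro exI[of _ 0]) (simp add: id_def del: funpow.simps power_Suc)
next
  case (insert i I)
  then obtain K where K: "K \<ge> 0" "\<And>n. (\<integral>\<^sup>+ f. ennreal (otrace (euler_step (2 ^ Suc n) (\<lambda>v. \<Sum>i\<in>I. Z (f i) v) ^^ (2 ^ Suc n)))
      \<partial>measure_pmf (Pi_pmf I dflt (\<lambda>_. p))) \<le> ennreal (card B * (1 + \<sigma>) ^ card I + K / 2 ^ Suc n)"
    by auto
  define a where "a = real (card I)"
  define E where "E = card B * (a * exp (a + 1))"
  \<comment> \<open>The old error is multiplied by \<open>1 + \<sigma>\<close>, and \<open>E\<close>
    is the new Golden-Thompson error, with \<open>a = card I\<close> bounding the norm of the
    partial sum and one that of the new summand.\<close>
  define K' where "K' = (1 + \<sigma>) * K + E"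
  have E0: "0 \<le> E" by (simp add: E_def a_def)
  have "(\<integral>\<^sup>+ f. ennreal (otrace (euler_step (2 ^ Suc n) (\<lambda>v. \<Sum>i\<in>insert i I. Z (f i) v) ^^ (2 ^ Suc n)))
      \<partial>measure_pmf (Pi_pmf (insert i I) dflt (\<lambda>_. p)))
     \<le> ennreal (card B * (1 + \<sigma>) ^ card (insert i I) + K' / 2 ^ Suc n)" for n
  proof -
    let ?N = "2 ^ Suc n :: nat"
    define S where "S f v = (\<Sum>i\<in>I. Z (f i) v)" for f v
    have S: "adj_pair (S f) (S f)" "norm_bound (S f) a" for f
      unfolding S_def a_def using norm_bound_sum[of I "\<lambda>i. Z (f i)" 1] insert.hyps norm_bound_Z
      by (auto intro: adj_pair_sum adj_pair_Z)
    have upd: "(\<lambda>v. \<Sum>i'\<in>insert i I. Z ((f(i := y)) i') v) = (\<lambda>v. S f v + Z y v)" for f y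
    proof
      fix v
      have "(\<Sum>i'\<in>I. Z ((f(i := y)) i') v) = S f v" unfolding S_def
        by (intro sum.cong) (use insert.hyps in auto)
      then show "(\<Sum>i'\<in>insert i I. Z ((f(i := y)) i') v) = S f v + Z y v"
        using insert.hyps by simp
    qed
    \<comment> \<open>The new coordinate is drawn last, so that the inner integral averages over it
      with the earlier summands fixed.\<close>
    have Pi: "Pi_pmf (insert i I) dflt (\<lambda>_. p) =
        bind_pmf (Pi_pmf I dflt (\<lambda>_. p)) (\<lambda>f. bind_pmf p (\<lambda>y. return_pmf (f(i := y))))"
      by (subst Pi_pmf_insert'[OF insert.hyps(1,2)], subst bind_commute_pmf) (rule refl)
    have "(\<integral>\<^sup>+ f. ennreal (otrace (euler_step ?N (\<lambda>v. \<Sum>i\<in>insert i I. Z (f i) v) ^^ ?N))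
          \<partial>measure_pmf (Pi_pmf (insert i I) dflt (\<lambda>_. p)))
        = (\<integral>\<^sup>+ f. (\<integral>\<^sup>+ y. ennreal (otrace (euler_step ?N (\<lambda>v. S f v + Z y v) ^^ ?N)) \<partial>measure_pmf p)
          \<partial>measure_pmf (Pi_pmf I dflt (\<lambda>_. p)))"
      by (simp only: Pi nn_integral_bind_pmf nn_integral_return_pmf[OF zero_le] upd)
    also have "\<dots> \<le> (\<integral>\<^sup>+ f. ennreal (1 + \<sigma>) * ennreal (otrace (euler_step ?N (S f) ^^ ?N)) + ennreal (E / ?N)
          \<partial>measure_pmf (Pi_pmf I dflt (\<lambda>_. p)))"
      unfolding E_def by (intro nn_integral_mono nn_integral_otrace_step S) (auto simp: a_def)
    also have "\<dots> = ennreal (1 + \<sigma>) * (\<integral>\<^sup>+ f. ennreal (otrace (euler_step ?N (S f) ^^ ?N))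
          \<partial>measure_pmf (Pi_pmf I dflt (\<lambda>_. p))) + ennreal (E / ?N)"
      by (simp add: nn_integral_add nn_integral_cmult)
    also have "\<dots> \<le> ennreal (1 + \<sigma>) * ennreal (card B * (1 + \<sigma>) ^ card I + K / 2 ^ Suc n) + ennreal (E / ?N)"
      using K(2)[of n] by (intro add_mono mult_left_mono) (auto simp: S_def[abs_def])
    also have "\<dots> = ennreal ((1 + \<sigma>) * (card B * (1 + \<sigma>) ^ card I + K / 2 ^ Suc n) + E / ?N)"
      using \<sigma>_nonneg K(1) E0 by (simp add: ennreal_plus ennreal_mult)
    also have "(1 + \<sigma>) * (card B * (1 + \<sigma>) ^ card I + K / 2 ^ Suc n) + E / ?N
        = card B * (1 + \<sigma>) ^ card (insert i I) + K' / 2 ^ Suc n"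
      using insert.hyps by (simp add: K'_def field_simps)
    finally show ?thesis .
  qed
  moreover have "K' \<ge> 0" using K(1) E0 \<sigma>_nonneg by (simp add: K'_def)
  ultimately show ?case by blast
qed

text \<open>Markov's inequality is applied to the trace at each finite \<open>n\<close>; only then
  does \<open>n\<close> tend to infinity, turning \<open>(1 + t / N)^N\<close> into
  \<open>exp t\<close> and removing the error \<open>K / N\<close>.\<close>

lemma prob_quadratic_form_ge:
  assumes I: "finite I" and t: "0 \<le> t"
  shows "measure_pmf.prob (Pi_pmf I dflt (\<lambda>_. p))
      {f. \<exists>v\<in>span B. norm v = 1 \<and> t \<le> inner (\<Sum>i\<in>I. Z (f i) v) v}
    \<le> card B * (1 + \<sigma>) ^ card I * exp (- t)"
proof -
  let ?P = "Pi_pmf I dflt (\<lambda>_. p)"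
  define Bad where "Bad = {f. \<exists>v\<in>span B. norm v = 1 \<and> t \<le> inner (\<Sum>i\<in>I. Z (f i) v) v}"
  obtain K where K: "K \<ge> 0" "\<And>n. (\<integral>\<^sup>+ f. ennreal (otrace (euler_step (2 ^ Suc n) (\<lambda>v. \<Sum>i\<in>I. Z (f i) v) ^^ (2 ^ Suc n)))
      \<partial>measure_pmf ?P) \<le> ennreal (card B * (1 + \<sigma>) ^ card I + K / 2 ^ Suc n)"
    using nn_integral_otrace_sum[OF I] by auto
  define R where "R = card B * (1 + \<sigma>) ^ card I"
  have R0: "0 \<le> R" using \<sigma>_nonneg by (simp add: R_def)
  have step: "(1 + t / real (2 ^ Suc n)) ^ (2 ^ Suc n) * measure_pmf.prob ?P Bad \<le> R + K / 2 ^ Suc n" for n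
  proof -
    let ?N = "2 ^ Suc n :: nat"
    let ?c = "(1 + t / real ?N) ^ ?N"
    have c0: "0 \<le> ?c" using t by simp
    have "ennreal (?c * measure_pmf.prob ?P Bad) = ennreal ?c * emeasure (measure_pmf ?P) Bad"
      using c0 by (simp add: ennreal_mult measure_pmf.emeasure_eq_measure)
    also have "\<dots> = (\<integral>\<^sup>+ f. ennreal ?c * indicator Bad f \<partial>measure_pmf ?P)"
      by (simp add: nn_integral_cmult)
    also have "\<dots> \<le> (\<integral>\<^sup>+ f. ennreal (otrace (euler_step ?N (\<lambda>v. \<Sum>i\<in>I. Z (f i) v) ^^ ?N)) \<partial>measure_pmf ?P)"
    proof (intro nn_integral_mono)
      fix f
      have "?c \<le> otrace (euler_step ?N (\<lambda>v. \<Sum>i\<in>I. Z (f i) v) ^^ ?N)" if f: "f \<in> Bad"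
      proof -
        obtain v where "v \<in> span B" "norm v = 1" "t \<le> inner (\<Sum>i\<in>I. Z (f i) v) v"
          using f unfolding Bad_def by blast
        then show ?thesis using t by (intro tail_le_otrace adj_pair_sum adj_pair_Z) auto
      qed
      then show "ennreal ?c * indicator Bad f \<le> ennreal (otrace (euler_step ?N (\<lambda>v. \<Sum>i\<in>I. Z (f i) v) ^^ ?N))"
        by (auto simp: indicator_def intro: ennreal_leI)
    qed
    also have "\<dots> \<le> ennreal (R + K / 2 ^ Suc n)" using K(2)[of n] by (simp add: R_def)
    finally show ?thesis using R0 K(1) by (subst (asm) ennreal_le_iff) auto
  qed
  have "(\<lambda>n. (1 + t / real (2 ^ Suc n)) ^ (2 ^ Suc n)) \<longlonglongrightarrow> exp t"
    by (rule filterlim_compose[OF tendsto_exp_limit_sequentially, of "\<lambda>n. 2 ^ Suc n"])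
      (rule filterlim_subseq, simp add: strict_mono_Suc_iff)
  then have "(\<lambda>n. (1 + t / real (2 ^ Suc n)) ^ (2 ^ Suc n) * measure_pmf.prob ?P Bad)
      \<longlonglongrightarrow> exp t * measure_pmf.prob ?P Bad" by (rule tendsto_mult_right)
  moreover have "(\<lambda>n. R + K / 2 ^ Suc n) \<longlonglongrightarrow> R + K * 0"
    unfolding divide_inverse
    by (intro tendsto_intros LIMSEQ_Suc[where f = "\<lambda>n. inverse (2 ^ n)"] LIMSEQ_inverse_realpow_zero) simp
  ultimately have "exp t * measure_pmf.prob ?P Bad \<le> R + K * 0"
    by (rule LIMSEQ_le) (use step in auto)
  then have "measure_pmf.prob ?P Bad \<le> R * exp (- t)" by (simp add: exp_minus field_simps)
  then show ?thesis by (simp add: Bad_def R_def)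
qed

end

end

section \<open>Operators of quadratic forms and the deviation of sampled functionals\<close>

context onb
begin

text \<open>For self-adjoint operators the numerical radius bounds the norm: polarise at
  \<open>x\<close> and a multiple of \<open>A x\<close>, then apply the parallelogram law.\<close>

lemma norm_bound_of_quadratic_form:
  assumes A: "adj_pair A A" and c: "\<And>x. x \<in> span B \<Longrightarrow> \<bar>inner (A x) x\<bar> \<le> c * (norm x)\<^sup>2"
  shows "norm_bound A c"
  unfolding norm_bound_def
proof
  fix x assume x: "x \<in> span B"
  have Ax: "A x \<in> span B" using A x by (auto simp: adj_pair_def endo_in)
  have lin: "linear A" using A by (auto simp: adj_pair_def endo_def)
  show "norm (A x) \<le> c * norm x"
  proof (cases "x = 0 \<or> A x = 0")
    case True
    have "c * norm x \<ge> 0" if "x \<noteq> 0"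
    proof -
      have "0 \<le> c * (norm x)\<^sup>2" using c[OF x] by (meson abs_ge_zero order_trans)
      then show ?thesis using that by (simp add: zero_le_mult_iff)
    qed
    then show ?thesis using True linear_0[OF lin] by (cases "x = 0") auto
  next
    case False
    \<comment> \<open>The direction of \<open>A x\<close> makes Cauchy-Schwarz an equality, and the
      length of \<open>x\<close> balances the two terms of the parallelogram law.\<close>
    define y where "y = (norm x / norm (A x)) *\<^sub>R A x"
    have y: "y \<in> span B" "norm y = norm x" using Ax False by (auto simp: y_def span_scale)
    have Axy: "inner (A x) y = norm x * norm (A x)"
      using False by (simp add: y_def power2_norm_eq_inner[symmetric] power2_eq_square)
    have sym: "inner (A y) x = inner (A x) y" using adj_pairD[OF A y(1) x] by (simp add: inner_commute)
    have "4 * (norm x * norm (A x)) = inner (A (x + y)) (x + y) - inner (A (x - y)) (x - y)"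
      unfolding Axy[symmetric] by (simp add: linear_add[OF lin] linear_diff[OF lin] inner_simps sym)
    also have "\<dots> \<le> c * (norm (x + y))\<^sup>2 + c * (norm (x - y))\<^sup>2"
      using c[OF span_add[OF x y(1)]] c[OF span_diff[OF x y(1)]] by linarith
    also have "\<dots> = 2 * c * ((norm x)\<^sup>2 + (norm y)\<^sup>2)"
    proof -
      have "(norm (x + y))\<^sup>2 + (norm (x - y))\<^sup>2 = 2 * ((norm x)\<^sup>2 + (norm y)\<^sup>2)"
        unfolding power2_norm_eq_inner
        by (simp add: inner_add_left inner_add_right inner_diff_left inner_diff_right)
      then show ?thesis by (simp only: distrib_left[symmetric])
    qed
    also have "\<dots> = 4 * (norm x * (c * norm x))" by (simp add: y(2) power2_eq_square)
    finally show ?thesis using False by simp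
  qed
qed

text \<open>The Riesz representative of a bilinear form. Only the values of \<open>h\<close> on
  basis pairs enter, so bilinearity is required only when the form is recovered from the
  operator.\<close>

definition form_op :: "('a \<Rightarrow> 'a \<Rightarrow> real) \<Rightarrow> 'a \<Rightarrow> 'a" where
  "form_op h x = (\<Sum>b\<in>B. (\<Sum>c\<in>B. inner x c * h c b) *\<^sub>R b)"

lemma inner_form_op: "inner (form_op h x) y = (\<Sum>b\<in>B. \<Sum>c\<in>B. inner x c * h c b * inner b y)"
  by (simp add: form_op_def inner_sum_left sum_distrib_right)

lemma adj_pair_form_op:
  assumes sym: "\<And>b c. b \<in> B \<Longrightarrow> c \<in> B \<Longrightarrow> h b c = h c b"
  shows "adj_pair (form_op h) (form_op h)"
proof -
  have "linear (form_op h)"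
    by (simp add: linear_iff form_op_def inner_add_left sum.distrib scaleR_sum_right scaleR_add_left
        sum_distrib_left mult.assoc distrib_right)
  then have "endo (form_op h)"
    by (auto simp: endo_def form_op_def intro!: span_sum span_scale intro: span_base)
  moreover have "inner (form_op h x) y = inner x (form_op h y)" for x y
  proof -
    have "inner x (form_op h y) = (\<Sum>b\<in>B. \<Sum>c\<in>B. inner y c * h c b * inner b x)"
      by (subst inner_commute) (rule inner_form_op)
    also have "\<dots> = (\<Sum>c\<in>B. \<Sum>b\<in>B. inner y c * h c b * inner b x)" by (rule sum.swap)
    also have "\<dots> = (\<Sum>c\<in>B. \<Sum>b\<in>B. inner x b * h b c * inner c y)"
      by (intro sum.cong refl) (simp add: sym inner_commute)
    finally show ?thesis by (simp add: inner_form_op)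
  qed
  ultimately show ?thesis by (simp add: adj_pair_def)
qed

context
  fixes p :: "'j pmf" and w :: "'j \<Rightarrow> 'a \<Rightarrow> complex" and R :: real
  assumes linear_w: "\<And>j. linear (w j)"
    and R: "1 \<le> R"
    and w_bound: "\<And>j v. v \<in> span B \<Longrightarrow> (cmod (w j v))\<^sup>2 \<le> R * (norm v)\<^sup>2"
    and w_mean: "\<And>v. v \<in> span B \<Longrightarrow> measure_pmf.expectation p (\<lambda>j. (cmod (w j v))\<^sup>2) \<le> (norm v)\<^sup>2"
begin

text \<open>The inner product is the real one of the plane of complex numbers; it gives a symmetric
  positive form whose diagonal is the squared modulus.\<close>

definition sample_form :: "'j \<Rightarrow> 'a \<Rightarrow> 'a \<Rightarrow> real" where
  "sample_form j x y = inner (w j x) (w j y)"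

definition mean_form :: "'a \<Rightarrow> 'a \<Rightarrow> real" where
  "mean_form x y = measure_pmf.expectation p (\<lambda>j. sample_form j x y)"

lemma sample_form_self: "sample_form j x x = (cmod (w j x))\<^sup>2"
  by (simp add: sample_form_def power2_norm_eq_inner)

lemma sample_form_sym: "sample_form j x y = sample_form j y x"
  by (simp add: sample_form_def inner_commute)

lemma mean_form_sym: "mean_form x y = mean_form y x"
  by (simp add: mean_form_def sample_form_sym[of _ x y])

lemma w_bound': "v \<in> span B \<Longrightarrow> cmod (w j v) \<le> sqrt R * norm v"
  using real_sqrt_le_mono[OF w_bound[of v j]] by (simp add: real_sqrt_mult)

lemma integrable_sample_form:
  assumes x: "x \<in> span B" and y: "y \<in> span B"
  shows "integrable (measure_pmf p) (\<lambda>j. sample_form j x y)"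
proof (rule measure_pmf.integrable_const_bound)
  have "\<bar>sample_form j x y\<bar> \<le> (sqrt R * norm x) * (sqrt R * norm y)" for j
  proof -
    have "\<bar>sample_form j x y\<bar> \<le> cmod (w j x) * cmod (w j y)" unfolding sample_form_def by (rule Cauchy_Schwarz_ineq2)
    also have "\<dots> \<le> (sqrt R * norm x) * (sqrt R * norm y)"
      using R by (intro mult_mono w_bound' x y) auto
    finally show ?thesis .
  qed
  then show "AE j in measure_pmf p. norm (sample_form j x y) \<le> (sqrt R * norm x) * (sqrt R * norm y)" by simp
qed simp

lemma sample_form_expand:
  assumes x: "x \<in> span B" and y: "y \<in> span B"
  shows "(\<Sum>b\<in>B. \<Sum>c\<in>B. inner x c * sample_form j c b * inner b y) = sample_form j x y"
proof -
  have "w j x = (\<Sum>c\<in>B. inner x c *\<^sub>R w j c)"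
    by (subst expand[OF x]) (simp add: linear_sum[OF linear_w] linear_scale[OF linear_w])
  moreover have "w j y = (\<Sum>b\<in>B. inner y b *\<^sub>R w j b)"
    by (subst expand[OF y]) (simp add: linear_sum[OF linear_w] linear_scale[OF linear_w])
  ultimately have "sample_form j x y = (\<Sum>b\<in>B. \<Sum>c\<in>B. inner y b * (inner x c * inner (w j c) (w j b)))"
    by (simp add: sample_form_def inner_sum_left inner_sum_right sum_distrib_left)
  also have "\<dots> = (\<Sum>b\<in>B. \<Sum>c\<in>B. inner x c * sample_form j c b * inner b y)"
    by (simp add: sample_form_def inner_commute[of y] mult_ac)
  finally show ?thesis by simp
qed

lemma inner_form_op_sample_form:
  "x \<in> span B \<Longrightarrow> y \<in> span B \<Longrightarrow> inner (form_op (sample_form j) x) y = sample_form j x y"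
  by (simp add: inner_form_op sample_form_expand)

lemma inner_form_op_mean_form:
  assumes x: "x \<in> span B" and y: "y \<in> span B"
  shows "inner (form_op mean_form x) y = mean_form x y"
proof -
  have "mean_form x y = measure_pmf.expectation p (\<lambda>j. \<Sum>b\<in>B. \<Sum>c\<in>B. inner x c * sample_form j c b * inner b y)"
    unfolding mean_form_def by (simp add: sample_form_expand[OF x y])
  also have "\<dots> = (\<Sum>b\<in>B. \<Sum>c\<in>B. inner x c * mean_form c b * inner b y)"
    by (simp add: mean_form_def integrable_sample_form span_base Bochner_Integration.integral_sum)
  finally show ?thesis by (simp add: inner_form_op)
qed

lemma mean_form_self_bounds:
  assumes "x \<in> span B"
  shows "0 \<le> mean_form x x" "mean_form x x \<le> (norm x)\<^sup>2"
  using w_mean[OF assms] by (auto simp: mean_form_def sample_form_self)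

text \<open>A positive operator \<open>A\<close> bounded by \<open>R\<close> satisfies
  \<open>A^2 \<le> R A\<close>. With \<open>u = A v\<close>, Cauchy-Schwarz gives the squared norm
  of \<open>u\<close> at most \<open>cmod (w j v) * sqrt R * norm u\<close>, and one factor
  \<open>norm u\<close> cancels.\<close>

lemma norm_form_op_sample_form_le:
  assumes v: "v \<in> span B"
  shows "(norm (form_op (sample_form j) v))\<^sup>2 \<le> R * sample_form j v v"
proof -
  let ?u = "form_op (sample_form j) v"
  have u: "?u \<in> span B" using adj_pair_form_op[of "sample_form j"] sample_form_sym v by (auto simp: adj_pair_def endo_in)
  have "(norm ?u)\<^sup>2 = sample_form j v ?u" using inner_form_op_sample_form[OF v u] by (simp add: power2_norm_eq_inner)
  also have "\<dots> \<le> cmod (w j v) * cmod (w j ?u)" unfolding sample_form_def by (rule norm_cauchy_schwarz)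
  also have "\<dots> \<le> cmod (w j v) * (sqrt R * norm ?u)" by (intro mult_left_mono w_bound' u) simp
  finally have "norm ?u * norm ?u \<le> (sqrt R * cmod (w j v)) * norm ?u"
    by (simp add: power2_eq_square mult_ac)
  then have "norm ?u \<le> sqrt R * cmod (w j v)"
    using R by (cases "norm ?u = 0") (auto simp: mult_le_cancel_right)
  then have "(norm ?u)\<^sup>2 \<le> (sqrt R * cmod (w j v))\<^sup>2" by (intro power_mono) auto
  also have "\<dots> = R * sample_form j v v" using R by (simp add: power_mult_distrib sample_form_self)
  finally show ?thesis .
qed

definition centred :: "real \<Rightarrow> 'j \<Rightarrow> 'a \<Rightarrow> 'a" where
  "centred \<theta> j v = \<theta> *\<^sub>R (form_op (sample_form j) v - form_op mean_form v)"

lemma centred_eq_form_op: "centred \<theta> j = form_op (\<lambda>x y. \<theta> * (sample_form j x y - mean_form x y))"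
  by (auto simp: fun_eq_iff centred_def form_op_def scaleR_diff_right scaleR_sum_right
      sum_subtractf[symmetric] scaleR_diff_left[symmetric] sum_distrib_left algebra_simps)

lemma adj_pair_centred: "adj_pair (centred \<theta> j) (centred \<theta> j)"
  unfolding centred_eq_form_op by (rule adj_pair_form_op) (simp add: sample_form_sym mean_form_sym)

lemma inner_centred:
  assumes "x \<in> span B" "y \<in> span B"
  shows "inner (centred \<theta> j x) y = \<theta> * (sample_form j x y - mean_form x y)"
  using assms by (simp add: centred_def inner_diff_left inner_form_op_sample_form inner_form_op_mean_form)

text \<open>The sampled form lies between 0 and \<open>R\<close>, the mean form between 0 and 1, and
  \<open>1 \<le> R\<close>; hence their difference is at most \<open>R\<close> in absolute
  value.\<close>

lemma norm_bound_centred: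
  assumes "\<bar>\<theta>\<bar> * R \<le> 1"
  shows "norm_bound (centred \<theta> j) 1"
proof (rule norm_bound_of_quadratic_form[OF adj_pair_centred])
  fix x assume x: "x \<in> span B"
  have "0 \<le> sample_form j x x" "sample_form j x x \<le> R * (norm x)\<^sup>2" using w_bound[OF x] by (auto simp: sample_form_self)
  moreover have "(norm x)\<^sup>2 \<le> R * (norm x)\<^sup>2" using R by (simp add: mult_le_cancel_right1)
  ultimately have "\<bar>sample_form j x x - mean_form x x\<bar> \<le> R * (norm x)\<^sup>2" using mean_form_self_bounds[OF x] by linarith
  then have "\<bar>inner (centred \<theta> j x) x\<bar> \<le> \<bar>\<theta>\<bar> * (R * (norm x)\<^sup>2)"
    by (simp add: inner_centred[OF x x] abs_mult mult_left_mono)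
  also have "\<dots> \<le> 1 * (norm x)\<^sup>2" using mult_right_mono[OF assms, of "(norm x)\<^sup>2"] by (simp add: mult.assoc)
  finally show "\<bar>inner (centred \<theta> j x) x\<bar> \<le> 1 * (norm x)\<^sup>2" .
qed

text \<open>The linear term has mean zero, and the variance is at most the mean of the squared
  operator, which is at most \<open>R\<close> times the mean operator.\<close>

lemma moment_centred:
  assumes \<theta>: "\<bar>\<theta>\<bar> * R \<le> 1" and v: "v \<in> span B"
  shows "measure_pmf.expectation p (\<lambda>j. inner (centred \<theta> j v) v + (norm (centred \<theta> j v))\<^sup>2)
    \<le> \<theta>\<^sup>2 * R * (norm v)\<^sup>2"
proof -
  let ?m = "form_op mean_form v"
  have m: "?m \<in> span B" using adj_pair_form_op[of mean_form] mean_form_sym v by (auto simp: adj_pair_def endo_in)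
  have gm: "mean_form v ?m = (norm ?m)\<^sup>2" using inner_form_op_mean_form[OF v m] by (simp add: power2_norm_eq_inner)
  \<comment> \<open>An integrable majorant that is affine in sampled forms, so its expectation
    follows from that of \<open>sample_form\<close>. The mixed term has mean twice the squared norm
    of \<open>?m\<close>, which leaves that square with a negative sign.\<close>
  define r where "r j = \<theta> * (sample_form j v v - mean_form v v) + \<theta>\<^sup>2 * (R * sample_form j v v - 2 * sample_form j v ?m + (norm ?m)\<^sup>2)" for j
  have "inner (centred \<theta> j v) v + (norm (centred \<theta> j v))\<^sup>2 \<le> r j" for j
  proof -
    let ?u = "form_op (sample_form j) v"
    have "(norm (centred \<theta> j v))\<^sup>2 = \<theta>\<^sup>2 * (norm (?u - ?m))\<^sup>2"
      by (simp add: centred_def power_mult_distrib)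
    also have "(norm (?u - ?m))\<^sup>2 = (norm ?u)\<^sup>2 - 2 * sample_form j v ?m + (norm ?m)\<^sup>2"
      using inner_form_op_sample_form[OF v m, of j]
      by (simp add: power2_norm_eq_inner inner_simps inner_commute[of ?m ?u])
    also have "\<theta>\<^sup>2 * \<dots> \<le> \<theta>\<^sup>2 * (R * sample_form j v v - 2 * sample_form j v ?m + (norm ?m)\<^sup>2)"
      using norm_form_op_sample_form_le[OF v, of j] by (intro mult_left_mono) auto
    finally show ?thesis by (simp add: r_def inner_centred[OF v v])
  qed
  then have "measure_pmf.expectation p (\<lambda>j. inner (centred \<theta> j v) v + (norm (centred \<theta> j v))\<^sup>2)
      \<le> measure_pmf.expectation p r"
    unfolding r_def
    by (intro integral_mono moment_integrable norm_bound_centred \<theta> v)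
      (auto intro!: integrable_sample_form v m Bochner_Integration.integrable_add Bochner_Integration.integrable_diff)
  also have "measure_pmf.expectation p r = \<theta>\<^sup>2 * (R * mean_form v v - 2 * mean_form v ?m + (norm ?m)\<^sup>2)"
    unfolding r_def by (simp add: integrable_sample_form v m mean_form_def[symmetric])
  also have "\<dots> \<le> \<theta>\<^sup>2 * (R * (norm v)\<^sup>2)"
  proof (rule mult_left_mono)
    have "R * mean_form v v \<le> R * (norm v)\<^sup>2" using mean_form_self_bounds(2)[OF v] R by (intro mult_left_mono) auto
    then show "R * mean_form v v - 2 * mean_form v ?m + (norm ?m)\<^sup>2 \<le> R * (norm v)\<^sup>2"
      unfolding gm using zero_le_power2[of "norm ?m"] by linarith
  qed simp
  finally show ?thesis by (simp add: mult.assoc)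
qed

lemma prob_sampling_deviation:
  assumes I: "finite I" "I \<noteq> {}" and \<delta>: "0 < \<delta>" "\<delta> < 1"
  shows "measure_pmf.prob (Pi_pmf I dflt (\<lambda>_. p)) {f. \<exists>v\<in>span B. norm v = 1 \<and>
      \<delta> < \<bar>1 / real (card I) * (\<Sum>i\<in>I. (cmod (w (f i) v))\<^sup>2)
        - measure_pmf.expectation p (\<lambda>j. (cmod (w j v))\<^sup>2)\<bar>}
    \<le> 2 * real (card B) * exp (- (real (card I) * \<delta>\<^sup>2 / (4 * R)))" (is "measure_pmf.prob ?P ?Bad \<le> _")
proof -
  define m where "m = real (card I)"
  \<comment> \<open>The minimiser of
    \<open>\<theta>\<^sup>2 * R - \<theta> * \<delta>\<close>.\<close>
  define \<theta> where "\<theta> = \<delta> / (2 * R)"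
  define t where "t = m * \<theta> * \<delta>"
  define E where "E \<theta> = {f. \<exists>v\<in>span B. norm v = 1 \<and> t \<le> inner (\<Sum>i\<in>I. centred \<theta> (f i) v) v}" for \<theta>
  have m0: "0 < m" using I by (simp add: m_def card_gt_0_iff)
  have \<theta>0: "0 < \<theta>" using \<delta> R by (simp add: \<theta>_def)
  have \<theta>R: "\<theta> * R \<le> 1" using \<delta> R by (simp add: \<theta>_def)
  have t0: "0 \<le> t" using m0 \<theta>0 \<delta> by (simp add: t_def)
  have one: "measure_pmf.prob ?P (E \<theta>') \<le> card B * exp (- (m * \<delta>\<^sup>2 / (4 * R)))" if \<theta>': "\<bar>\<theta>'\<bar> = \<theta>" for \<theta>'
  proof -
    have sq: "\<theta>'\<^sup>2 = \<theta>\<^sup>2" using \<theta>' by (metis power2_abs)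
    have "measure_pmf.prob ?P (E \<theta>') \<le> card B * (1 + \<theta>'\<^sup>2 * R) ^ card I * exp (- t)"
      unfolding E_def using \<theta>' \<theta>R R t0
      by (intro prob_quadratic_form_ge adj_pair_centred norm_bound_centred moment_centred I) auto
    also have "\<dots> \<le> card B * exp (\<theta>\<^sup>2 * R) ^ card I * exp (- t)"
      unfolding sq using R by (intro mult_right_mono mult_left_mono power_mono) auto
    also have "\<dots> = card B * exp (m * (\<theta>\<^sup>2 * R) - t)"
      by (simp add: exp_of_nat_mult[symmetric] m_def exp_diff exp_minus field_simps)
    also have "m * (\<theta>\<^sup>2 * R) - t = - (m * \<delta>\<^sup>2 / (4 * R))"
      using R by (simp add: t_def \<theta>_def field_simps power2_eq_square)
    finally show ?thesis .
  qed
  \<comment> \<open>The one-sided bound is used with both signs, one for each sign of the deviation;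
    this is the factor 2 in the conclusion.\<close>
  have "?Bad \<subseteq> E \<theta> \<union> E (- \<theta>)"
  proof
    fix f assume "f \<in> ?Bad"
    then obtain v where v: "v \<in> span B" "norm v = 1"
      and dev: "\<delta> < \<bar>1 / m * (\<Sum>i\<in>I. sample_form (f i) v v) - mean_form v v\<bar>"
      by (auto simp: m_def mean_form_def sample_form_self)
    define s where "s = (\<Sum>i\<in>I. sample_form (f i) v v) - m * mean_form v v"
    have "1 / m * (\<Sum>i\<in>I. sample_form (f i) v v) - mean_form v v = s / m"
      using m0 by (simp add: s_def diff_divide_distrib)
    then have "\<bar>1 / m * (\<Sum>i\<in>I. sample_form (f i) v v) - mean_form v v\<bar> = \<bar>s\<bar> / m"
      using m0 by simp
    then have "m * \<delta> < \<bar>s\<bar>" using dev m0 by (simp add: pos_less_divide_eq mult.commute)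
    then have "\<theta> * (m * \<delta>) \<le> \<theta> * \<bar>s\<bar>" using \<theta>0 by (intro mult_left_mono) auto
    then have ts: "t \<le> \<theta> * \<bar>s\<bar>" by (simp add: t_def mult_ac)
    have eq: "inner (\<Sum>i\<in>I. centred \<theta>' (f i) v) v = \<theta>' * s" for \<theta>'
      by (simp add: inner_sum_left inner_centred[OF v(1) v(1)] sum_distrib_left[symmetric] sum_subtractf
          s_def m_def)
    show "f \<in> E \<theta> \<union> E (- \<theta>)"
    proof (cases "0 \<le> s")
      case True
      then have "t \<le> inner (\<Sum>i\<in>I. centred \<theta> (f i) v) v" using ts by (simp add: eq)
      then show ?thesis using v unfolding E_def by blast
    next
      case False
      then have "t \<le> inner (\<Sum>i\<in>I. centred (- \<theta>) (f i) v) v" using ts by (simp add: eq)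
      then show ?thesis using v unfolding E_def by blast
    qed
  qed
  then have "measure_pmf.prob ?P ?Bad \<le> measure_pmf.prob ?P (E \<theta> \<union> E (- \<theta>))"
    by (intro measure_pmf.finite_measure_mono) auto
  also have "\<dots> \<le> measure_pmf.prob ?P (E \<theta>) + measure_pmf.prob ?P (E (- \<theta>))"
    by (intro measure_Un_le) auto
  also have "\<dots> \<le> card B * exp (- (m * \<delta>\<^sup>2 / (4 * R))) + card B * exp (- (m * \<delta>\<^sup>2 / (4 * R)))"
    using \<theta>0 by (intro add_mono one) auto
  finally show ?thesis by (simp add: m_def)
qed

end

end

section \<open>Linear pieces of a network\<close>

definition shatters :: "'a set set \<Rightarrow> 'a set \<Rightarrow> bool" where
  "shatters \<F> S \<longleftrightarrow> (\<forall>U\<subseteq>S. \<exists>X\<in>\<F>. X \<inter> S = U)"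

text \<open>Pajor's form of the Sauer-Shelah lemma: a family shatters at least as many sets as it
  has members. It reduces the counting of patterns to bounding the size of a shattered set.\<close>

lemma card_le_card_shattered:
  assumes "finite A" "\<F> \<subseteq> Pow A"
  shows "card \<F> \<le> card {S. S \<subseteq> A \<and> shatters \<F> S}"
  using assms
proof (induction A arbitrary: \<F> rule: finite_induct)
  case empty
  then have "\<F> = {} \<or> \<F> = {{}}" by auto
  then show ?case
  proof
    assume "\<F> = {{}}"
    then have "{S. S \<subseteq> {} \<and> shatters \<F> S} = {{}}" by (auto simp: shatters_def)
    then show ?thesis using \<open>\<F> = {{}}\<close> by simp
  qed simp
next
  case (insert a A)
  \<comment> \<open>Members without \<open>a\<close>, and members with \<open>a\<close> after its
    removal. A set shattered by the union is shattered by \<open>\<F>\<close>; one shattered by the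
    intersection stays so after adding \<open>a\<close>, since both choices at \<open>a\<close> are
    realised.\<close>
  define Fn where "Fn = {X \<in> \<F>. a \<notin> X}"
  define Fa where "Fa = (\<lambda>X. X - {a}) ` {X \<in> \<F>. a \<in> X}"
  have sub: "Fn \<subseteq> Pow A" "Fa \<subseteq> Pow A" using insert.prems by (auto simp: Fn_def Fa_def)
  have fin: "finite Fn" "finite Fa" using sub insert.hyps finite_subset by auto
  have finF: "finite \<F>" using insert.prems insert.hyps by (meson finite_Pow_iff finite_insert finite_subset)
  have "\<F> = Fn \<union> {X \<in> \<F>. a \<in> X}" by (auto simp: Fn_def)
  moreover have "card (Fn \<union> {X \<in> \<F>. a \<in> X}) = card Fn + card {X \<in> \<F>. a \<in> X}"
    by (rule card_Un_disjoint) (auto simp: Fn_def finF)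
  moreover have "card Fa = card {X \<in> \<F>. a \<in> X}" unfolding Fa_def
    by (rule card_image) (auto simp: inj_on_def)
  ultimately have "card \<F> = card Fn + card Fa" by simp
  also have "\<dots> = card (Fn \<union> Fa) + card (Fn \<inter> Fa)" using fin by (rule card_Un_Int)
  also have "\<dots> \<le> card {S. S \<subseteq> A \<and> shatters (Fn \<union> Fa) S} + card {S. S \<subseteq> A \<and> shatters (Fn \<inter> Fa) S}"
    using sub by (intro add_mono insert.IH) auto
  also have "card {S. S \<subseteq> A \<and> shatters (Fn \<inter> Fa) S}
      = card (insert a ` {S. S \<subseteq> A \<and> shatters (Fn \<inter> Fa) S})"
    by (rule card_image[symmetric]) (use insert.hyps in \<open>auto simp: inj_on_def\<close>)
  also have "card {S. S \<subseteq> A \<and> shatters (Fn \<union> Fa) S} + card (insert a ` {S. S \<subseteq> A \<and> shatters (Fn \<inter> Fa) S})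
      = card ({S. S \<subseteq> A \<and> shatters (Fn \<union> Fa) S} \<union> insert a ` {S. S \<subseteq> A \<and> shatters (Fn \<inter> Fa) S})"
    using insert.hyps by (intro card_Un_disjoint[symmetric]) auto
  also have "\<dots> \<le> card {S. S \<subseteq> insert a A \<and> shatters \<F> S}"
  proof (rule card_mono)
    show "finite {S. S \<subseteq> insert a A \<and> shatters \<F> S}" using insert.hyps by simp
    have 1: "shatters \<F> S" if S: "S \<subseteq> A" "shatters (Fn \<union> Fa) S" for S
      unfolding shatters_def
    proof (intro allI impI)
      fix U assume "U \<subseteq> S"
      then obtain X where X: "X \<in> Fn \<union> Fa" "X \<inter> S = U"
        using S(2)[unfolded shatters_def, rule_format, of U] by blast
      have "a \<notin> S" using S insert.hyps by auto
      have "X \<in> Fn \<or> (\<exists>Y\<in>\<F>. X = Y - {a})" using X(1) by (auto simp: Fa_def)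
      then show "\<exists>X\<in>\<F>. X \<inter> S = U"
      proof
        assume "X \<in> Fn"
        then show ?thesis using X(2) by (auto simp: Fn_def)
      next
        assume "\<exists>Y\<in>\<F>. X = Y - {a}"
        then obtain Y where Y: "Y \<in> \<F>" "X = Y - {a}" by blast
        then have "Y \<inter> S = U" using X(2) \<open>a \<notin> S\<close> by auto
        then show ?thesis using Y(1) by blast
      qed
    qed
    have 2: "shatters \<F> (insert a S)" if S: "S \<subseteq> A" "shatters (Fn \<inter> Fa) S" for S
      unfolding shatters_def
    proof (intro allI impI)
      fix U assume U: "U \<subseteq> insert a S"
      have aS: "a \<notin> S" using S insert.hyps by auto
      have "U - {a} \<subseteq> S" using U by auto
      then obtain X where X: "X \<in> Fn" "X \<in> Fa" "X \<inter> S = U - {a}"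
        using S(2)[unfolded shatters_def, rule_format, of "U - {a}"] by blast
      have X1: "X \<in> \<F>" "a \<notin> X" using X by (auto simp: Fn_def)
      obtain Y where Y: "Y \<in> \<F>" "a \<in> Y" "X = Y - {a}" using X(2) unfolding Fa_def by blast
      then have X2: "insert a X \<in> \<F>" by (simp add: insert_absorb)
      show "\<exists>X\<in>\<F>. X \<inter> insert a S = U"
      proof (cases "a \<in> U")
        case True
        then show ?thesis using X X2 by (intro bexI[of _ "insert a X"]) auto
      next
        case False
        then show ?thesis using X X1 by (intro bexI[of _ X]) auto
      qed
    qed
    show "{S. S \<subseteq> A \<and> shatters (Fn \<union> Fa) S} \<union> insert a ` {S. S \<subseteq> A \<and> shatters (Fn \<inter> Fa) S}
        \<subseteq> {S. S \<subseteq> insert a A \<and> shatters \<F> S}"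
      using 1 2 by auto
  qed
  finally show ?case .
qed

text \<open>Gaussian elimination on the last coordinate: a pivot \<open>j0\<close> clears it from
  the other vectors, and its own coefficient is chosen afterwards to restore the relation.\<close>

lemma nontrivial_relation:
  fixes f :: "'a \<Rightarrow> nat \<Rightarrow> real"
  assumes "finite S" "k < card S"
  shows "\<exists>c. (\<exists>j\<in>S. c j \<noteq> 0) \<and> (\<forall>i<k. (\<Sum>j\<in>S. c j * f j i) = 0)"
  using assms
proof (induction k arbitrary: S f)
  case 0
  then show ?case by (intro exI[of _ "\<lambda>_. 1"]) (auto simp: card_gt_0_iff)
next
  case (Suc k)
  show ?case
  proof (cases "\<forall>j\<in>S. f j k = 0")
    case True
    obtain c where "\<exists>j\<in>S. c j \<noteq> 0" "\<forall>i<k. (\<Sum>j\<in>S. c j * f j i) = 0"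
      using Suc.IH[of S f] Suc.prems by auto
    then show ?thesis using True by (intro exI[of _ c]) (auto simp: less_Suc_eq)
  next
    case False
    then obtain j0 where j0: "j0 \<in> S" "f j0 k \<noteq> 0" by auto
    define g where "g j i = f j i - f j k / f j0 k * f j0 i" for j i
    have "k < card (S - {j0})" using Suc.prems j0 by simp
    then obtain c where c: "\<exists>j\<in>S - {j0}. c j \<noteq> 0" "\<forall>i<k. (\<Sum>j\<in>S - {j0}. c j * g j i) = 0"
      using Suc.IH[of "S - {j0}" g] Suc.prems by auto
    define c' where "c' j = (if j = j0 then - (\<Sum>j\<in>S - {j0}. c j * f j k / f j0 k) else c j)" for j
    have "(\<Sum>j\<in>S. c' j * f j i) = 0" if "i < Suc k" for i
    proof -
      have "(\<Sum>j\<in>S. c' j * f j i) = c' j0 * f j0 i + (\<Sum>j\<in>S - {j0}. c' j * f j i)"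
        using Suc.prems j0 by (simp add: sum.remove)
      also have "(\<Sum>j\<in>S - {j0}. c' j * f j i) = (\<Sum>j\<in>S - {j0}. c j * f j i)"
        by (intro sum.cong) (auto simp: c'_def)
      also have "c' j0 * f j0 i = - (\<Sum>j\<in>S - {j0}. c j * f j k / f j0 k * f j0 i)"
        by (simp add: c'_def sum_distrib_right)
      also have "- (\<Sum>j\<in>S - {j0}. c j * f j k / f j0 k * f j0 i) + (\<Sum>j\<in>S - {j0}. c j * f j i)
          = (\<Sum>j\<in>S - {j0}. c j * g j i)"
        by (simp add: g_def sum_negf[symmetric] sum.distrib[symmetric] algebra_simps)
      also have "\<dots> = 0"
      proof (cases "i = k")
        case True
        then have "g j i = 0" for j using j0 by (simp add: g_def)
        then show ?thesis by simp
      qed (use c that in auto)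
      finally show ?thesis .
    qed
    moreover have "\<exists>j\<in>S. c' j \<noteq> 0" using c(1) by (auto simp: c'_def)
    ultimately show ?thesis by blast
  qed
qed

definition sign_pattern :: "real mat \<Rightarrow> real Matrix.vec \<Rightarrow> nat set" where
  "sign_pattern M z = {j. j < dim_row M \<and> 0 < vec_index (M *\<^sub>v z) j}"

text \<open>More than \<open>k\<close> rows are linearly dependent. Shattering would provide a
  \<open>z\<close> whose outputs have the signs of the coefficients, making every term of the
  vanishing combination nonnegative and one positive.\<close>

lemma card_shattered_sign_patterns_le:
  assumes M: "M \<in> carrier_mat n k" and S: "S \<subseteq> {..<n}" "shatters (sign_pattern M ` carrier_vec k) S"
  shows "card S \<le> k"
proof (rule ccontr)
  assume "\<not> card S \<le> k"
  moreover have fS: "finite S" using S finite_subset by blast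
  ultimately obtain c0 where c0: "\<exists>j\<in>S. c0 j \<noteq> 0" "\<forall>i<k. (\<Sum>j\<in>S. c0 j * M $$ (j, i)) = 0"
    using nontrivial_relation[of S k "\<lambda>j i. M $$ (j, i)"] by auto
  \<comment> \<open>A pattern records only strict positivity, so an output paired with a negative
    coefficient may be zero. Some coefficient must therefore be positive; negate the relation if
    necessary.\<close>
  obtain c where c: "\<exists>j\<in>S. 0 < c j" "\<forall>i<k. (\<Sum>j\<in>S. c j * M $$ (j, i)) = 0"
  proof (cases "\<exists>j\<in>S. 0 < c0 j")
    case False
    obtain j where "j \<in> S" "c0 j \<noteq> 0" using c0(1) by blast
    moreover from this False have "c0 j < 0" by (meson linorder_neqE_linordered_idom)
    ultimately have "\<exists>j\<in>S. 0 < - c0 j" by (intro bexI[of _ j]) simp_all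
    moreover have "\<forall>i<k. (\<Sum>j\<in>S. - c0 j * M $$ (j, i)) = 0" using c0(2) by (simp add: sum_negf)
    ultimately show ?thesis by (rule that)
  next
    case True
    then show ?thesis using c0(2) by (rule that)
  qed
  obtain z where z: "z \<in> carrier_vec k" "sign_pattern M z \<inter> S = {j \<in> S. 0 < c j}"
    using S(2)[unfolded shatters_def, rule_format, of "{j \<in> S. 0 < c j}"] by auto
  let ?y = "\<lambda>j. vec_index (M *\<^sub>v z) j"
  have y: "?y j = (\<Sum>i<k. M $$ (j, i) * vec_index z i)" if "j \<in> S" for j
    using that M S(1) z(1) by (auto simp: scalar_prod_def atLeast0LessThan subset_iff)
  have "(\<Sum>j\<in>S. c j * ?y j) = (\<Sum>j\<in>S. \<Sum>i<k. c j * M $$ (j, i) * vec_index z i)"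
    by (intro sum.cong) (simp_all add: y sum_distrib_left mult.assoc)
  also have "\<dots> = (\<Sum>i<k. (\<Sum>j\<in>S. c j * M $$ (j, i)) * vec_index z i)"
    by (subst sum.swap) (simp add: sum_distrib_right)
  also have "\<dots> = 0" using c(2) by (intro sum.neutral) auto
  finally have eq0: "(\<Sum>j\<in>S. c j * ?y j) = 0" .
  have pos: "0 < ?y j \<longleftrightarrow> 0 < c j" if "j \<in> S" for j
  proof -
    have "j < dim_row M" using that S(1) M by auto
    then have "j \<in> sign_pattern M z \<longleftrightarrow> 0 < ?y j" by (simp add: sign_pattern_def)
    then show ?thesis using z(2) that by blast
  qed
  have nn: "0 \<le> c j * ?y j" if "j \<in> S" for j
    using pos[OF that] by (cases "0 < c j") (auto simp: not_less mult_nonpos_nonpos)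
  obtain j where j: "j \<in> S" "0 < c j" using c(1) by auto
  have "c j * ?y j = 0" using sum_nonneg_eq_0_iff[OF fS, of "\<lambda>j. c j * ?y j"] nn eq0 j(1) by auto
  moreover have "0 < c j * ?y j" using pos[OF j(1)] j(2) by simp
  ultimately show False by linarith
qed

text \<open>With \<open>x = k / n \<le> 1\<close>, multiplication by \<open>x^k\<close> is dominated
  termwise by \<open>x^i\<close>; the binomial theorem and \<open>1 + x \<le> exp x\<close> then
  give \<open>exp k\<close>.\<close>

lemma sum_binomial_le:
  assumes "1 \<le> k" "k \<le> n"
  shows "(\<Sum>i\<le>k. real (n choose i)) \<le> (exp 1 * real n / real k) ^ k"
proof -
  let ?x = "real k / real n"
  have x: "0 < ?x" "?x \<le> 1" using assms by auto
  have "(\<Sum>i\<le>k. real (n choose i)) * ?x ^ k = (\<Sum>i\<le>k. real (n choose i) * ?x ^ k)"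
    by (simp add: sum_distrib_right)
  also have "\<dots> \<le> (\<Sum>i\<le>k. real (n choose i) * ?x ^ i)"
    using x by (intro sum_mono mult_left_mono power_decreasing) auto
  also have "\<dots> \<le> (\<Sum>i\<le>n. real (n choose i) * ?x ^ i)"
    using assms by (intro sum_mono2) auto
  also have "\<dots> = (?x + 1) ^ n" by (simp add: binomial_ring)
  also have "\<dots> \<le> exp ?x ^ n" using x exp_ge_add_one_self[of ?x] by (intro power_mono) (simp_all add: add.commute)
  also have "\<dots> = exp 1 ^ k" using assms by (simp add: exp_of_nat_mult[symmetric])
  finally have "(\<Sum>i\<le>k. real (n choose i)) \<le> exp 1 ^ k / ?x ^ k"
    using x by (simp add: pos_le_divide_eq)
  also have "\<dots> = (exp 1 * real n / real k) ^ k"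
    by (simp add: power_divide power_mult_distrib)
  finally show ?thesis .
qed

lemma card_sign_patterns_le:
  assumes M: "M \<in> carrier_mat n k" and k: "1 \<le> k" "k \<le> n"
  shows "real (card (sign_pattern M ` carrier_vec k)) \<le> (exp 1 * real n / real k) ^ k"
proof -
  let ?F = "sign_pattern M ` carrier_vec k"
  have "card ?F \<le> card {S. S \<subseteq> {..<n} \<and> shatters ?F S}"
    by (rule card_le_card_shattered) (use M in \<open>auto simp: sign_pattern_def\<close>)
  also have "\<dots> \<le> card (\<Union>i\<in>{..k}. {S. S \<subseteq> {..<n} \<and> card S = i})"
    using card_shattered_sign_patterns_le[OF M] by (intro card_mono) auto
  also have "\<dots> \<le> (\<Sum>i\<in>{..k}. card {S. S \<subseteq> {..<n} \<and> card S = i})"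
    by (rule card_UN_le) simp
  also have "\<dots> = (\<Sum>i\<le>k. n choose i)" by (simp add: n_subsets)
  finally have "real (card ?F) \<le> (\<Sum>i\<le>k. real (n choose i))" by (metis of_nat_le_iff of_nat_sum)
  then show ?thesis using sum_binomial_le[OF k] by simp
qed

section \<open>Conic pieces on which the layers are linear\<close>

definition vec_cone :: "nat \<Rightarrow> real Matrix.vec set \<Rightarrow> bool" where
  "vec_cone k K \<longleftrightarrow> K \<subseteq> carrier_vec k \<and> 0\<^sub>v k \<in> K \<and> (\<forall>x\<in>K. \<forall>y\<in>K. x + y \<in> K) \<and>
     (\<forall>x\<in>K. \<forall>c\<ge>0. c \<cdot>\<^sub>v x \<in> K)"

definition linear_pieces ::
  "nat \<Rightarrow> nat \<Rightarrow> (real Matrix.vec \<Rightarrow> real Matrix.vec) \<Rightarrow> (real Matrix.vec set \<times> real mat) set \<Rightarrow> bool" where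
  "linear_pieces k n f P \<longleftrightarrow> finite P \<and>
     (\<forall>(K, L)\<in>P. vec_cone k K \<and> L \<in> carrier_mat n k \<and> (\<forall>z\<in>K. f z = L *\<^sub>v z)) \<and>
     carrier_vec k \<subseteq> (\<Union>(K, L)\<in>P. K)"

text \<open>Both inequalities are weak, so the cone contains zero and is closed under sums.
  Neighbouring cones overlap where an output vanishes, and there the masked matrices agree.\<close>

definition sign_cone :: "real mat \<Rightarrow> nat set \<Rightarrow> real Matrix.vec set" where
  "sign_cone M U = {z \<in> carrier_vec (dim_col M). \<forall>j<dim_row M.
     if j \<in> U then 0 \<le> vec_index (M *\<^sub>v z) j else vec_index (M *\<^sub>v z) j \<le> 0}"

definition mask_rows :: "nat set \<Rightarrow> real mat \<Rightarrow> real mat" where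
  "mask_rows U M = Matrix.mat (dim_row M) (dim_col M) (\<lambda>(j, i). if j \<in> U then M $$ (j, i) else 0)"

lemma vec_cone_sign_cone:
  assumes "M \<in> carrier_mat n k"
  shows "vec_cone k (sign_cone M U)"
proof -
  have "M *\<^sub>v 0\<^sub>v k = 0\<^sub>v n" using assms by auto
  moreover have "M *\<^sub>v (x + y) = M *\<^sub>v x + M *\<^sub>v y" if "x \<in> carrier_vec k" "y \<in> carrier_vec k" for x y
    using assms that by (rule mult_add_distrib_mat_vec)
  moreover have "M *\<^sub>v (c \<cdot>\<^sub>v x) = c \<cdot>\<^sub>v (M *\<^sub>v x)" if "x \<in> carrier_vec k" for c x
    using assms that by (rule mult_mat_vec)
  ultimately show ?thesis using assms unfolding vec_cone_def sign_cone_def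
    by (auto simp del: index_mult_mat_vec simp: mult_nonneg_nonpos intro!: add_nonpos_nonpos)
qed

lemma vec_cone_Int: "vec_cone k K \<Longrightarrow> vec_cone k K' \<Longrightarrow> vec_cone k (K \<inter> K')"
  unfolding vec_cone_def by blast

lemma relu_eq_mask_rows:
  assumes "M \<in> carrier_mat n k" "z \<in> sign_cone M U"
  shows "relu (M *\<^sub>v z) = mask_rows U M *\<^sub>v z"
proof (rule eq_vecI)
  show d: "dim_vec (relu (M *\<^sub>v z)) = dim_vec (mask_rows U M *\<^sub>v z)"
    by (simp add: relu_def mask_rows_def)
  fix j assume "j < dim_vec (mask_rows U M *\<^sub>v z)"
  then have j: "j < dim_row M" by (simp add: mask_rows_def)
  have z: "dim_vec z = dim_col M" using assms(2) by (auto simp: sign_cone_def)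
  have "vec_index (relu (M *\<^sub>v z)) j = max 0 (vec_index (M *\<^sub>v z) j)"
    using j by (simp add: relu_def)
  also have "\<dots> = (if j \<in> U then vec_index (M *\<^sub>v z) j else 0)"
    using assms(2) j by (auto simp: sign_cone_def simp del: index_mult_mat_vec)
  also have "\<dots> = vec_index (mask_rows U M *\<^sub>v z) j"
    using j z by (simp add: mask_rows_def scalar_prod_def)
  finally show "vec_index (relu (M *\<^sub>v z)) j = vec_index (mask_rows U M *\<^sub>v z) j" .
qed

text \<open>On a piece the preactivation is \<open>A * L\<close>, a matrix with \<open>k\<close>
  columns however wide the layer is, so each piece splits into at most \<open>(e n' / k)^k\<close>
  new ones. The patterns are counted over all of the input space, which covers those met on
  \<open>K\<close>.\<close>

lemma linear_pieces_relu:
  assumes P: "linear_pieces k n f P" and A: "A \<in> carrier_mat n' n" and k: "1 \<le> k" "k \<le> n'"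
  shows "\<exists>P'. linear_pieces k n' (\<lambda>z. relu (A *\<^sub>v f z)) P' \<and>
    real (card P') \<le> real (card P) * (exp 1 * real n' / real k) ^ k"
proof -
  define Q where "Q = (\<lambda>(K :: real Matrix.vec set, L). (\<lambda>U. (K \<inter> sign_cone (A * L) U, mask_rows U (A * L))) `
    (sign_pattern (A * L) ` carrier_vec k))"
  define P' where "P' = (\<Union>x\<in>P. Q x)"
  have fin: "finite P" using P by (simp add: linear_pieces_def)
  have PD: "vec_cone k K" "L \<in> carrier_mat n k" "\<And>z. z \<in> K \<Longrightarrow> f z = L *\<^sub>v z" if "(K, L) \<in> P" for K L
    using P that by (auto simp: linear_pieces_def)
  have AL: "A * L \<in> carrier_mat n' k" if "(K, L) \<in> P" for K L
    using A PD(2)[OF that] by simp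
  have finpat: "finite (sign_pattern M ` carrier_vec k)" for M
    by (rule finite_subset[of _ "Pow {..<dim_row M}"]) (auto simp: sign_pattern_def)
  have finQ: "finite (Q x)" for x unfolding Q_def using finpat by (cases x) auto
  have cardQ: "real (card (Q x)) \<le> (exp 1 * real n' / real k) ^ k" if "x \<in> P" for x
  proof -
    obtain K L where x: "x = (K, L)" by (cases x)
    have "card (Q x) \<le> card (sign_pattern (A * L) ` carrier_vec k)"
      unfolding Q_def x using finpat by (auto intro: card_image_le)
    then show ?thesis using card_sign_patterns_le[OF AL k, of K L] that x by simp
  qed
  have "card P' \<le> (\<Sum>x\<in>P. card (Q x))" unfolding P'_def by (rule card_UN_le[OF fin])
  then have "real (card P') \<le> (\<Sum>x\<in>P. real (card (Q x)))" by (metis of_nat_le_iff of_nat_sum)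
  also have "\<dots> \<le> (\<Sum>x\<in>P. (exp 1 * real n' / real k) ^ k)" by (intro sum_mono cardQ)
  finally have card: "real (card P') \<le> real (card P) * (exp 1 * real n' / real k) ^ k" by simp
  have piece: "vec_cone k K' \<and> L' \<in> carrier_mat n' k \<and> (\<forall>z\<in>K'. relu (A *\<^sub>v f z) = L' *\<^sub>v z)"
    if KL': "(K', L') \<in> P'" for K' L'
  proof -
    obtain x where x: "x \<in> P" "(K', L') \<in> Q x" using KL' unfolding P'_def by blast
    obtain K L where xKL: "x = (K, L)" by (cases x)
    have KL: "(K, L) \<in> P" using x(1) xKL by simp
    obtain U where eq: "K' = K \<inter> sign_cone (A * L) U" "L' = mask_rows U (A * L)"
      using x(2) unfolding Q_def xKL by auto
    have "relu (A *\<^sub>v f z) = L' *\<^sub>v z" if z: "z \<in> K'" for z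
    proof -
      have zk: "z \<in> K" "z \<in> carrier_vec k" using z PD(1)[OF KL] by (auto simp: eq vec_cone_def)
      have "A *\<^sub>v f z = (A * L) *\<^sub>v z" using PD(2,3)[OF KL] zk A by simp
      then show ?thesis using relu_eq_mask_rows[OF AL[OF KL]] z by (simp add: eq)
    qed
    moreover have "L' \<in> carrier_mat n' k" using A PD(2)[OF KL] by (simp add: eq mask_rows_def)
    ultimately show ?thesis unfolding eq using vec_cone_Int[OF PD(1)[OF KL] vec_cone_sign_cone[OF AL[OF KL]]] by simp
  qed
  have cover: "z \<in> (\<Union>(K', L')\<in>P'. K')" if z: "z \<in> carrier_vec k" for z
  proof -
    obtain K L where KL: "(K, L) \<in> P" "z \<in> K" using P z by (auto simp: linear_pieces_def)
    let ?U = "sign_pattern (A * L) z"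
    have "z \<in> sign_cone (A * L) ?U" using z AL[OF KL(1)]
      by (auto simp: sign_cone_def sign_pattern_def not_less simp del: index_mult_mat_vec)
    moreover have "(K \<inter> sign_cone (A * L) ?U, mask_rows ?U (A * L)) \<in> P'"
      unfolding P'_def Q_def using z by (intro UN_I[OF KL(1)]) simp
    ultimately show ?thesis using KL(2) by blast
  qed
  have "linear_pieces k n' (\<lambda>z. relu (A *\<^sub>v f z)) P'"
    unfolding linear_pieces_def
  proof (intro conjI subsetI cover)
    show "finite P'" using finQ fin by (simp add: P'_def)
    show "\<forall>(K, L)\<in>P'. vec_cone k K \<and> L \<in> carrier_mat n' k \<and> (\<forall>z\<in>K. relu (A *\<^sub>v f z) = L *\<^sub>v z)"
      using piece by blast
  qed
  then show ?thesis using card by blast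
qed

lemma linear_pieces_layer:
  assumes A: "\<And>i. i \<in> {1..d} \<Longrightarrow> A i \<in> carrier_mat (n i) (n (i - 1))"
    and n: "n 0 = k" "1 \<le> k" "\<And>i. i \<le> d \<Longrightarrow> k \<le> n i \<and> n i \<le> N"
    and i: "i \<le> d"
  shows "\<exists>P. linear_pieces k (n i) (layer A i) P \<and> real (card P) \<le> ((exp 1 * real N / real k) ^ k) ^ i"
  using i
proof (induction i)
  case 0
  have "linear_pieces k (n 0) (layer A 0) {(carrier_vec k, 1\<^sub>m k)}"
    using n by (auto simp: linear_pieces_def vec_cone_def)
  then show ?case by (intro exI conjI) (assumption, simp)
next
  case (Suc i)
  let ?q = "(exp 1 * real N / real k) ^ k"
  obtain P where P: "linear_pieces k (n i) (layer A i) P" "real (card P) \<le> ?q ^ i"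
    using Suc by auto
  have "A (Suc i) \<in> carrier_mat (n (Suc i)) (n i)" using A[of "Suc i"] Suc.prems by simp
  moreover have "k \<le> n (Suc i)" using n(3)[OF Suc.prems] ..
  moreover have "(\<lambda>z. relu (A (Suc i) *\<^sub>v layer A i z)) = layer A (Suc i)" by (rule ext) simp
  ultimately obtain P' where P': "linear_pieces k (n (Suc i)) (layer A (Suc i)) P'"
      "real (card P') \<le> real (card P) * (exp 1 * real (n (Suc i)) / real k) ^ k"
    using linear_pieces_relu[OF P(1) _ n(2)] by metis
  note P'(2)
  also have "real (card P) * (exp 1 * real (n (Suc i)) / real k) ^ k \<le> ?q ^ i * ?q"
    using P(2) n(3)[OF Suc.prems] by (intro mult_mono power_mono divide_right_mono) auto
  finally have "real (card P') \<le> ?q ^ Suc i" by (simp add: mult.commute)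
  then show ?case using P'(1) by blast
qed

lemma clinear_on_vec_expand:
  assumes W: "clinear_on_vec n W" and u: "u \<in> carrier_vec n"
  shows "W u = (\<Sum>i<n. vec_index u i *\<^sub>C W (unit_vec n i))"
proof -
  have add: "W (x + y) = W x + W y" if "x \<in> carrier_vec n" "y \<in> carrier_vec n" for x y
    using W that by (auto simp: clinear_on_vec_def)
  have scale: "W (c \<cdot>\<^sub>v x) = c *\<^sub>C W x" if "x \<in> carrier_vec n" for c x
    using W that by (auto simp: clinear_on_vec_def)
  have *: "W (Matrix.vec n (\<lambda>i. if i < m then vec_index u i else 0)) = (\<Sum>i<m. vec_index u i *\<^sub>C W (unit_vec n i))"
    if "m \<le> n" for m
    using that
  proof (induction m)
    case 0
    \<comment> \<open>Zero is written as a multiple by zero so that homogeneity yields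
      \<open>W 0 = 0\<close>.\<close>
    have "Matrix.vec n (\<lambda>i. if i < 0 then vec_index u i else 0) = 0 \<cdot>\<^sub>v 0\<^sub>v n" by auto
    then show ?case using scale[of "0\<^sub>v n" 0] by simp
  next
    case (Suc m)
    have "Matrix.vec n (\<lambda>i. if i < Suc m then vec_index u i else 0)
       = Matrix.vec n (\<lambda>i. if i < m then vec_index u i else 0) + vec_index u m \<cdot>\<^sub>v unit_vec n m"
      using Suc.prems by (intro eq_vecI) (auto simp: less_Suc_eq)
    then show ?case using Suc by (simp add: add scale)
  qed
  have "Matrix.vec n (\<lambda>i. if i < n then vec_index u i else 0) = u" using u by auto
  then show ?thesis using *[of n] by simp
qed

lemma network_pieces:
  assumes G: "generative_network k d n G"
  shows "\<exists>P :: (real Matrix.vec set \<times> (nat \<Rightarrow> ell2)) set. finite P \<and>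
    real (card P) \<le> (exp 1 * real (n d) / real k) ^ (k * d) \<and>
    (\<forall>(K, g)\<in>P. vec_cone k K \<and> (\<forall>z\<in>K. G z = (\<Sum>l<k. vec_index z l *\<^sub>R g l))) \<and>
    carrier_vec k \<subseteq> (\<Union>(K, g)\<in>P. K)"
proof -
  from G obtain A W where n: "1 \<le> d" "2 \<le> k" "n 0 = k" "\<And>i. i < d \<Longrightarrow> n i \<le> n (Suc i)"
    and A: "\<And>i. i \<in> {1..d} \<Longrightarrow> A i \<in> carrier_mat (n i) (n (i - 1))"
    and W: "clinear_on_vec (n d) W" and Gz: "\<And>z. z \<in> carrier_vec k \<Longrightarrow> G z = network d A W z"
    unfolding generative_network_def by blast
  have mono: "n i \<le> n j" if "i \<le> j" "j \<le> d" for i j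
    using that by (induction rule: dec_induct) (use n(4) in \<open>auto intro: order_trans\<close>)
  have nk: "k \<le> n i \<and> n i \<le> n d" if "i \<le> d" for i
    using mono[of 0 i] mono[of i d] that n by auto
  obtain P where P: "linear_pieces k (n d) (layer A d) P"
      "real (card P) \<le> ((exp 1 * real (n d) / real k) ^ k) ^ d"
    using linear_pieces_layer[of d A n k "n d" d] A n nk by auto
  \<comment> \<open>\<open>h L l\<close> is the image under \<open>W\<close> of column
    \<open>l\<close> of \<open>L\<close>, so these \<open>k\<close> vectors span the image of the
    piece over the reals.\<close>
  define h where "h L = (\<lambda>l. \<Sum>i<n d. L $$ (i, l) *\<^sub>R W (unit_vec (n d) i))" for L :: "real mat"
  define P' where "P' = (\<lambda>(K :: real Matrix.vec set, L). (K, h L)) ` P"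
  have fin: "finite P" using P by (simp add: linear_pieces_def)
  have "card P' \<le> card P" unfolding P'_def by (rule card_image_le[OF fin])
  then have card: "real (card P') \<le> (exp 1 * real (n d) / real k) ^ (k * d)"
    using P(2) by (simp add: power_mult)
  have GL: "G z = (\<Sum>l<k. vec_index z l *\<^sub>R h L l)" if "(K, L) \<in> P" "z \<in> K" for K L z
  proof -
    have L: "L \<in> carrier_mat (n d) k" and z: "z \<in> carrier_vec k" and eq: "layer A d z = L *\<^sub>v z"
      using P(1) that by (auto simp: linear_pieces_def vec_cone_def)
    have "G z = W (map_vec complex_of_real (L *\<^sub>v z))" using Gz[OF z] eq by (simp add: network_def)
    also have "\<dots> = (\<Sum>i<n d. vec_index (L *\<^sub>v z) i *\<^sub>R W (unit_vec (n d) i))"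
      using L z by (subst clinear_on_vec_expand[OF W]) (auto simp: scaleR_eq_scaleC)
    also have "\<dots> = (\<Sum>i<n d. \<Sum>l<k. (L $$ (i, l) * vec_index z l) *\<^sub>R W (unit_vec (n d) i))"
      using L z by (intro sum.cong) (auto simp: scalar_prod_def atLeast0LessThan scaleR_sum_left)
    also have "\<dots> = (\<Sum>l<k. vec_index z l *\<^sub>R h L l)"
      by (subst sum.swap) (simp add: h_def scaleR_sum_right mult.commute)
    finally show ?thesis .
  qed
  have "\<forall>(K, g)\<in>P'. vec_cone k K \<and> (\<forall>z\<in>K. G z = (\<Sum>l<k. vec_index z l *\<^sub>R g l))"
    using P(1) GL by (auto simp: P'_def linear_pieces_def)
  moreover have "carrier_vec k \<subseteq> (\<Union>(K, g)\<in>P'. K)"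
  proof -
    have "(\<Union>(K, g)\<in>P'. K) = (\<Union>(K, L)\<in>P. K)" by (simp add: P'_def case_prod_beta)
    then show ?thesis using P(1) by (simp add: linear_pieces_def)
  qed
  moreover have "finite P'" using fin by (simp add: P'_def)
  ultimately show ?thesis using card by blast
qed

section \<open>Cone decomposition of the difference set and orthonormal bases\<close>

lemma convex_cone_image_vec_cone:
  assumes "vec_cone k K"
  shows "convex_cone ((\<lambda>z. \<Sum>l<k. vec_index z l *\<^sub>R g l) ` K)"
proof -
  let ?g = "\<lambda>z. \<Sum>l<k. vec_index z l *\<^sub>R g l"
  have K: "z \<in> carrier_vec k" if "z \<in> K" for z using assms that by (auto simp: vec_cone_def)
  have "0 = ?g (0\<^sub>v k)" by simp
  moreover have "?g x + ?g y = ?g (x + y)" if "x \<in> K" "y \<in> K" for x y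
    using K[OF that(1)] K[OF that(2)] by (auto simp: sum.distrib[symmetric] scaleR_add_left)
  moreover have "c *\<^sub>R ?g x = ?g (c \<cdot>\<^sub>v x)" if "x \<in> K" for c x
    using K[OF that] by (auto simp: scaleR_sum_right)
  moreover have "0\<^sub>v k \<in> K" "\<And>x y. x \<in> K \<Longrightarrow> y \<in> K \<Longrightarrow> x + y \<in> K"
      "\<And>c x. 0 \<le> c \<Longrightarrow> x \<in> K \<Longrightarrow> c \<cdot>\<^sub>v x \<in> K"
    using assms by (auto simp: vec_cone_def)
  ultimately show ?thesis unfolding convex_cone_iff
    by (intro conjI ballI allI impI) (auto simp del: index_add_vec index_smult_vec intro: image_eqI[of _ _ "0\<^sub>v k"])
qed

lemma convex_cone_differences:
  assumes "convex_cone C" "convex_cone D"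
  shows "convex_cone {a - b | a b. a \<in> C \<and> b \<in> D}"
  unfolding convex_cone_iff
proof (intro conjI ballI allI impI)
  show "0 \<in> {a - b | a b. a \<in> C \<and> b \<in> D}"
    using assms unfolding convex_cone_iff by force
next
  fix x y assume "x \<in> {a - b | a b. a \<in> C \<and> b \<in> D}" "y \<in> {a - b | a b. a \<in> C \<and> b \<in> D}"
  then obtain a b a' b' where "x = a - b" "y = a' - b'" "a \<in> C" "a' \<in> C" "b \<in> D" "b' \<in> D" by blast
  then show "x + y \<in> {a - b | a b. a \<in> C \<and> b \<in> D}"
    using assms by (intro CollectI exI[of _ "a + a'"] exI[of _ "b + b'"]) (auto intro: convex_cone_add)
next
  fix x and c :: real assume "x \<in> {a - b | a b. a \<in> C \<and> b \<in> D}" and c: "0 \<le> c"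
  then obtain a b where "x = a - b" "a \<in> C" "b \<in> D" by blast
  then show "c *\<^sub>R x \<in> {a - b | a b. a \<in> C \<and> b \<in> D}"
    using assms c by (intro CollectI exI[of _ "c *\<^sub>R a"] exI[of _ "c *\<^sub>R b"])
      (auto intro: convex_cone_scaleR simp: scaleR_diff_right)
qed

text \<open>Each ordered pair of pieces gives one cone of differences: this squares the count and
  doubles the dimension bound, whence the exponent \<open>2 * k * d\<close> and the
  \<open>2 * k\<close> generators.\<close>

lemma network_differences_cones:
  assumes G: "generative_network k d n G"
    and T: "T = {a - b | a b. a \<in> G ` carrier_vec k \<and> b \<in> G ` carrier_vec k}"
  shows "\<exists>\<D>. cone_decomposition \<D> T \<and>
    real (card \<D>) \<le> (exp 1 * real (n d) / real k) ^ (2 * k * d) \<and>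
    (\<forall>D\<in>\<D>. \<exists>X. finite X \<and> card X \<le> 2 * k \<and> D \<subseteq> span X)"
proof -
  obtain P :: "(real Matrix.vec set \<times> (nat \<Rightarrow> ell2)) set" where fin: "finite P"
    and card: "real (card P) \<le> (exp 1 * real (n d) / real k) ^ (k * d)"
    and P0: "\<forall>(K, g)\<in>P. vec_cone k K \<and> (\<forall>z\<in>K. G z = (\<Sum>l<k. vec_index z l *\<^sub>R g l))"
    and cover: "carrier_vec k \<subseteq> (\<Union>(K, g)\<in>P. K)"
    using network_pieces[OF G] by blast
  have P: "vec_cone k K" "z \<in> K \<Longrightarrow> G z = (\<Sum>l<k. vec_index z l *\<^sub>R g l)" if "(K, g) \<in> P" for K g z
    using P0 that by auto
  define C where "C = (\<lambda>(K :: real Matrix.vec set, g :: nat \<Rightarrow> ell2). (\<lambda>z. \<Sum>l<k. vec_index z l *\<^sub>R g l) ` K)"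
  define D where "D = (\<lambda>(x, y). {a - b | a b. a \<in> C x \<and> b \<in> C y})"
  have CG: "C x = G ` fst x" if "x \<in> P" for x
    using P(2) that by (cases x) (auto simp: C_def)
  have range: "G ` carrier_vec k = (\<Union>x\<in>P. C x)"
  proof -
    have "carrier_vec k = (\<Union>x\<in>P. fst x)"
      using cover P(1) by (force simp: vec_cone_def)
    then show ?thesis using CG by auto
  qed
  have cone: "convex_cone (C x)" if "x \<in> P" for x
  proof -
    obtain K g where "x = (K, g)" by (cases x)
    then show ?thesis using convex_cone_image_vec_cone[OF P(1)[of K g]] that by (simp add: C_def)
  qed
  have "T = \<Union>(D ` (P \<times> P))" unfolding T range D_def by auto
  then have dec: "cone_decomposition (D ` (P \<times> P)) T"
    using cone fin by (auto simp: cone_decomposition_def D_def intro!: convex_cone_differences)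
  have "card (D ` (P \<times> P)) \<le> card (P \<times> P)" by (rule card_image_le) (use fin in auto)
  then have "real (card (D ` (P \<times> P))) \<le> real (card P) * real (card P)"
    by (metis card_cartesian_product of_nat_le_iff of_nat_mult)
  also have "\<dots> \<le> (exp 1 * real (n d) / real k) ^ (k * d) * (exp 1 * real (n d) / real k) ^ (k * d)"
    by (intro mult_mono card) auto
  also have "\<dots> = (exp 1 * real (n d) / real k) ^ (2 * k * d)"
    by (simp add: power_add[symmetric] mult_2 distrib_right)
  finally have card2: "real (card (D ` (P \<times> P))) \<le> (exp 1 * real (n d) / real k) ^ (2 * k * d)" .
  have "\<exists>X. finite X \<and> card X \<le> 2 * k \<and> D (x, y) \<subseteq> span X" for x y
  proof (intro exI conjI)
    let ?X = "snd x ` {..<k} \<union> snd y ` {..<k}"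
    show "finite ?X" by simp
    have "card (snd x ` {..<k}) \<le> k" "card (snd y ` {..<k}) \<le> k"
      using card_image_le[of "{..<k}" "snd x"] card_image_le[of "{..<k}" "snd y"] by auto
    then show "card ?X \<le> 2 * k" using card_Un_le[of "snd x ` {..<k}" "snd y ` {..<k}"] by linarith
    have C_span: "C x \<subseteq> span (snd x ` {..<k})" for x
    proof
      fix v assume "v \<in> C x"
      then obtain z where v: "v = (\<Sum>l<k. vec_index z l *\<^sub>R snd x l)" by (cases x) (auto simp: C_def)
      show "v \<in> span (snd x ` {..<k})" unfolding v by (intro span_sum span_scale span_base) simp
    qed
    have "C x \<subseteq> span ?X" by (rule order_trans[OF C_span span_mono]) simp
    moreover have "C y \<subseteq> span ?X" by (rule order_trans[OF C_span span_mono]) simp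
    ultimately show "D (x, y) \<subseteq> span ?X" unfolding D_def by (auto intro!: span_diff)
  qed
  then have "\<forall>E\<in>D ` (P \<times> P). \<exists>X. finite X \<and> card X \<le> 2 * k \<and> E \<subseteq> span X" by auto
  then show ?thesis using dec card2 by blast
qed

lemma orthonormal_basis_of_span:
  fixes S X :: "'a::real_inner set"
  assumes X: "finite X" "S \<subseteq> span X"
  shows "\<exists>B. finite B \<and> (\<forall>b\<in>B. \<forall>c\<in>B. inner b c = (if b = c then 1 else 0)) \<and>
    span B = span S \<and> card B \<le> card X"
proof -
  \<comment> \<open>\<open>S\<close> is typically an infinite cone; a maximal independent subset is
    finite because \<open>S\<close> lies in the span of \<open>X\<close>, and it is then
    orthogonalised and normalised.\<close>
  obtain S' where S': "S' \<subseteq> S" "independent S'" "S \<subseteq> span S'" by (rule maximal_independent_subset)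
  have finS': "finite S'" "card S' \<le> card X" using independent_span_bound[OF X(1) S'(2)] S'(1) X(2) by auto
  have spanS': "span S' = span S"
    using S' by (metis span_mono span_minimal subspace_span subset_antisym)
  obtain C where C: "finite C" "card C \<le> card S'" "span C = span S'" "pairwise orthogonal C"
    using basis_orthogonal[OF finS'(1)] by auto
  define C' where "C' = C - {0}"
  define B where "B = (\<lambda>x. inverse (norm x) *\<^sub>R x) ` C'"
  have "span B = span C'" unfolding B_def
    by (rule span_image_scale) (auto simp: C'_def C(1))
  also have "\<dots> = span S" using C(3) spanS' by (simp add: C'_def span_delete_0)
  finally have sp: "span B = span S" .
  have fin: "finite C'" using C(1) by (simp add: C'_def)
  have "card B \<le> card C'" unfolding B_def by (rule card_image_le[OF fin])
  also have "\<dots> \<le> card X" using C(1,2) finS'(2) card_mono[of C C'] by (auto simp: C'_def)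
  finally have card: "card B \<le> card X" .
  have "inner b c = (if b = c then 1 else 0)" if bc: "b \<in> B" "c \<in> B" for b c
  proof -
    obtain x y where xy: "x \<in> C'" "b = inverse (norm x) *\<^sub>R x" "y \<in> C'" "c = inverse (norm y) *\<^sub>R y"
      using bc by (auto simp: B_def)
    show ?thesis
    proof (cases "x = y")
      case True
      then show ?thesis using xy by (simp add: C'_def power2_norm_eq_inner[symmetric] power2_eq_square)
    next
      case False
      then have "inner x y = 0" using C(4) xy by (auto simp: C'_def pairwise_def orthogonal_def)
      then have "inner b c = 0" using xy by simp
      moreover have "b \<noteq> c"
      proof
        assume "b = c"
        then have "inner b b = 0" using \<open>inner b c = 0\<close> by simp
        then show False using xy by (simp add: C'_def)
      qed
      ultimately show ?thesis by simp
    qed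
  qed
  then show ?thesis using fin sp card by (intro exI[of _ B]) (auto simp: B_def)
qed

section \<open>Sampling\<close>

definition basis_index :: "ell2 \<Rightarrow> nat option" where
  "basis_index v = (if v \<in> range basis_vec then Some (THE j. v = basis_vec j) else None)"

lemma basis_index_eq_Some_iff: "basis_index v = Some j \<longleftrightarrow> v = basis_vec j"
  by (auto simp: basis_index_def inj_eq[OF inj_basis_vec])

lemma basis_index_eq_None_iff: "basis_index v = None \<longleftrightarrow> v \<notin> range basis_vec"
  by (simp add: basis_index_def)

lemma sampling_eq_basis_index:
  "sampling s y i = (case basis_index (s i) of Some j \<Rightarrow> y j | None \<Rightarrow> 0)"
  by (simp add: sampling_def basis_index_def)

lemma measurable_basis_index: "basis_index \<in> borel \<rightarrow>\<^sub>M count_space UNIV"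
proof (subst measurable_count_space_eq_countable)
  have Some: "basis_index -` {Some j} = {basis_vec j}" for j
    by (auto simp: basis_index_eq_Some_iff)
  have None: "basis_index -` {None} = UNIV - (\<Union>j. {basis_vec j})"
    by (auto simp: basis_index_eq_None_iff)
  have "basis_index -` {a} \<in> sets borel" for a
  proof (cases a)
    case None
    show ?thesis unfolding None \<open>basis_index -` {None} = _\<close> by measurable
  next
    case (Some j)
    show ?thesis unfolding Some \<open>\<And>j. basis_index -` {Some j} = _\<close> by measurable
  qed
  then show "basis_index \<in> space borel \<rightarrow> UNIV \<and> (\<forall>a\<in>UNIV. basis_index -` {a} \<inter> space borel \<in> sets borel)"
    by simp
qed simp

text \<open>Only the probabilities of the basis vectors are given. They sum to one, so the remaining
  value \<open>None\<close> has probability zero and the law of the index is determined.\<close>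

lemma distr_basis_index:
  assumes M: "prob_space M" and X: "X \<in> M \<rightarrow>\<^sub>M borel"
    and distr: "\<And>j. measure M {\<omega> \<in> space M. X \<omega> = basis_vec j} = pmf p j"
  shows "distr M (count_space UNIV) (\<lambda>\<omega>. basis_index (X \<omega>)) = measure_pmf (map_pmf Some p)"
    (is "?D = ?N")
proof -
  interpret prob_space M by (rule M)
  have meas: "(\<lambda>\<omega>. basis_index (X \<omega>)) \<in> M \<rightarrow>\<^sub>M count_space UNIV"
    using measurable_comp[OF X measurable_basis_index] by (simp add: comp_def)
  interpret D: prob_space ?D by (rule prob_space_distr[OF meas])
  have Some: "emeasure ?D {Some j} = emeasure ?N {Some j}" for j
  proof -
    have "emeasure ?D {Some j} = emeasure M {\<omega> \<in> space M. X \<omega> = basis_vec j}"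
      by (subst emeasure_distr[OF meas]) (auto intro!: arg_cong[where f = "emeasure M"] simp: basis_index_eq_Some_iff)
    also have "\<dots> = ennreal (pmf p j)" by (simp add: emeasure_eq_measure distr)
    also have "\<dots> = emeasure ?N {Some j}"
      by (simp add: emeasure_pmf_single pmf_map_inj')
    finally show ?thesis .
  qed
  have range: "emeasure ?D (\<Union>j. {Some j}) = emeasure ?N (\<Union>j. {Some j})"
  proof -
    have "emeasure ?D (\<Union>j. {Some j}) = (\<Sum>j. emeasure ?D {Some j})"
      by (rule suminf_emeasure[symmetric]) (auto simp: disjoint_family_on_def)
    also have "\<dots> = (\<Sum>j. emeasure ?N {Some j})" by (simp only: Some)
    also have "\<dots> = emeasure ?N (\<Union>j. {Some j})"
      by (rule suminf_emeasure) (auto simp: disjoint_family_on_def)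
    finally show ?thesis .
  qed
  have None: "{None} = UNIV - (\<Union>j. {Some j :: nat option})"
  proof (rule Set.set_eqI)
    fix x show "x \<in> {None} \<longleftrightarrow> x \<in> UNIV - (\<Union>j. {Some j :: nat option})" by (cases x) auto
  qed
  have "emeasure ?D {None} = emeasure ?N {None}"
  proof -
    have "measure ?D (\<Union>j. {Some j}) = measure ?N (\<Union>j. {Some j})" using range by (simp add: measure_def)
    then have "measure ?D {None} = measure ?N {None}"
      unfolding None using D.prob_compl[of "\<Union>j. {Some j}"] measure_pmf.prob_compl[of "\<Union>j. {Some j}" "map_pmf Some p"]
      by simp
    then show ?thesis by (simp add: D.emeasure_eq_measure measure_pmf.emeasure_eq_measure)
  qed
  with Some have "emeasure ?D {a} = emeasure ?N {a}" for a by (cases a) auto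
  then show ?thesis by (intro measure_eqI_countable[of _ UNIV]) auto
qed

text \<open>Carries the abstract sample to a product of discrete laws. \<open>E\<close> is an
  arbitrary predicate, so a supremum over uncountably many vectors is admissible in it.\<close>

lemma sample_event_prob:
  assumes M: "prob_space M" and indep: "prob_space.indep_vars M (\<lambda>_. borel) s I"
    and I: "finite I" "I \<noteq> {}"
    and distr: "\<And>i j. i \<in> I \<Longrightarrow> measure M {\<omega> \<in> space M. s i \<omega> = basis_vec j} = pmf p j"
  shows "measure M {\<omega> \<in> space M. E (\<lambda>i\<in>I. basis_index (s i \<omega>))} =
    measure_pmf.prob (Pi_pmf I dflt (\<lambda>_. p)) {f. E (\<lambda>i\<in>I. Some (f i))}"
proof -
  interpret prob_space M by (rule M)
  \<comment> \<open>The default is \<open>Some dflt\<close> so that \<open>Q\<close> is the image of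
    the product of \<open>p\<close> under composition with \<open>Some\<close>, also outside
    \<open>I\<close>.\<close>
  define Q where "Q = Pi_pmf I (Some dflt) (\<lambda>_. map_pmf Some p)"
  let ?C = "\<lambda>_. count_space (UNIV :: nat option set)"
  have s: "s i \<in> M \<rightarrow>\<^sub>M borel" if "i \<in> I" for i
    using indep that by (simp add: indep_vars_def)
  have X: "(\<lambda>\<omega>. basis_index (s i \<omega>)) \<in> M \<rightarrow>\<^sub>M count_space UNIV" if "i \<in> I" for i
    using measurable_comp[OF s[OF that] measurable_basis_index] by (simp add: comp_def)
  have "indep_vars ?C (\<lambda>i \<omega>. basis_index (s i \<omega>)) I"
    by (rule indep_vars_compose2[OF indep]) (rule measurable_basis_index)
  then have "distr M (PiM I ?C) (\<lambda>\<omega>. \<lambda>i\<in>I. basis_index (s i \<omega>))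
      = PiM I (\<lambda>i. distr M (count_space UNIV) (\<lambda>\<omega>. basis_index (s i \<omega>)))"
    using indep_vars_iff_distr_eq_PiM'[OF I(2), where M' = ?C and X = "\<lambda>i \<omega>. basis_index (s i \<omega>)"] X by simp
  also have "\<dots> = PiM I (\<lambda>_. measure_pmf (map_pmf Some p))"
    by (intro PiM_cong refl distr_basis_index M s distr)
  finally have 1: "distr M (PiM I ?C) (\<lambda>\<omega>. \<lambda>i\<in>I. basis_index (s i \<omega>)) = PiM I (\<lambda>_. measure_pmf (map_pmf Some p))" .
  have "distr Q (PiM I ?C) (\<lambda>f. \<lambda>i\<in>I. f i) = PiM I (\<lambda>i. distr Q (count_space UNIV) (\<lambda>f. f i))"
    using prob_space.indep_vars_iff_distr_eq_PiM'[OF measure_pmf.prob_space_axioms[of Q] I(2), where M' = ?C and X = "\<lambda>i f. f i"]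
      indep_vars_Pi_pmf[OF I(1), of "Some dflt" "\<lambda>_. map_pmf Some p"] by (simp add: Q_def)
  also have "\<dots> = PiM I (\<lambda>_. measure_pmf (map_pmf Some p))"
    using I(1) by (intro PiM_cong refl) (simp add: Q_def Pi_pmf_component flip: map_pmf_rep_eq)
  finally have 2: "distr Q (PiM I ?C) (\<lambda>f. \<lambda>i\<in>I. f i) = PiM I (\<lambda>_. measure_pmf (map_pmf Some p))" .
  define A where "A = {g \<in> PiE I (\<lambda>_. UNIV). E g}"
  \<comment> \<open>A finite product of countable discrete spaces is discrete, so every set of
    extensional functions is measurable.\<close>
  have A: "A \<in> sets (PiM I ?C)"
    using I(1) by (subst count_space_PiM_finite) (auto simp: A_def)
  have "measure M {\<omega> \<in> space M. E (\<lambda>i\<in>I. basis_index (s i \<omega>))}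
      = measure (distr M (PiM I ?C) (\<lambda>\<omega>. \<lambda>i\<in>I. basis_index (s i \<omega>))) A"
    by (subst measure_distr[OF measurable_restrict[OF X] A])
      (auto intro!: arg_cong[where f = "measure M"] simp: A_def)
  also have "\<dots> = measure (distr Q (PiM I ?C) (\<lambda>f. \<lambda>i\<in>I. f i)) A" by (simp only: 1 2)
  also have "\<dots> = measure_pmf.prob Q {f. E (\<lambda>i\<in>I. f i)}"
    by (subst measure_distr[OF measurable_restrict A])
      (auto intro!: arg_cong[where f = "measure Q"] simp: A_def)
  also have "Q = map_pmf (\<lambda>f. Some \<circ> f) (Pi_pmf I dflt (\<lambda>_. p))"
    unfolding Q_def by (rule Pi_pmf_map[OF I(1)]) simp
  also have "measure_pmf.prob \<dots> {f. E (\<lambda>i\<in>I. f i)} =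
      measure_pmf.prob (Pi_pmf I dflt (\<lambda>_. p)) {f. E (\<lambda>i\<in>I. Some (f i))}"
    by (simp add: vimage_def comp_def)
  finally show ?thesis .
qed

section \<open>Weighted coordinates, coherence, and the deviation on one subspace\<close>

lemma expectation_weighting:
  "measure_pmf.expectation p (\<lambda>j. (cmod (weighting p y j))\<^sup>2) = (norm (support_proj p y))\<^sup>2"
proof -
  \<comment> \<open>The weight \<open>1 / sqrt (pmf p j)\<close> cancels the sampling probability on
    the support; off the support both sides vanish.\<close>
  have eq: "pmf p j * (cmod (weighting p y j))\<^sup>2 = (cmod (coord (support_proj p y) j))\<^sup>2" for j
    by (simp add: weighting_def support_proj.rep_eq norm_divide power_divide)
  have "measure_pmf.expectation p (\<lambda>j. (cmod (weighting p y j))\<^sup>2)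
      = integral\<^sup>L (count_space UNIV) (\<lambda>j. (cmod (coord (support_proj p y) j))\<^sup>2)"
    unfolding measure_pmf_eq_density by (subst integral_density) (simp_all add: eq)
  also have "\<dots> = (\<Sum>j. (cmod (coord (support_proj p y) j))\<^sup>2)"
    by (rule integral_count_space_nat) (simp add: integrable_count_space_nat_iff ell2_summable)
  also have "\<dots> = (norm (support_proj p y))\<^sup>2"
    by (simp add: norm_ell2_def suminf_nonneg ell2_summable)
  finally show ?thesis .
qed

lemma norm_support_proj_le: "norm (support_proj p y) \<le> norm y"
  unfolding norm_ell2_def
  by (intro real_sqrt_le_mono suminf_le ell2_summable) (auto simp: support_proj.rep_eq)

lemma linear_weighting:
  assumes F: "unitary_op F"
  shows "linear (\<lambda>x. weighting p (F x) j)"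
proof -
  have "F (x + y) = F x + F y" "F (c *\<^sub>C x) = c *\<^sub>C F x" for x y c
    using F by (auto simp: unitary_op_def Vector_Spaces.linear_def module_hom_def module_hom_axioms_def)
  then show ?thesis
    by (auto simp: linear_iff weighting_def plus_ell2.rep_eq scaleR_eq_scaleC scaleC.rep_eq add_divide_distrib
        scaleR_conv_of_real)
qed

lemma norm_unitary: "unitary_op F \<Longrightarrow> norm (F x) = norm x"
  by (simp add: unitary_op_def norm_eq_sqrt_inner inner_ell2_def)

text \<open>Connects the two scalar fields: concentration runs on the real span, and the coherence
  bound is available on the complex one.\<close>

lemma real_span_subset_complex_span: "span S \<subseteq> ell2.span S"
proof (rule span_minimal[OF ell2.span_superset])
  show "subspace (ell2.span S)"
    by (auto simp: subspace_def ell2.span_zero ell2.span_add ell2.span_scale scaleR_eq_scaleC)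
qed

text \<open>Coherence speaks of unit vectors, so \<open>v\<close> is normalised.
  \<open>Delta T\<close> is a union of subspaces; the assumption \<open>sub\<close> keeps the
  multiples of \<open>v\<close> inside it.\<close>

lemma weighting_coherence_bound:
  assumes F: "unitary_op F" and c: "coherence_mu T F p = ereal c" "0 \<le> c" and v: "v \<in> Delta T"
    and sub: "\<And>r. r *\<^sub>R v \<in> Delta T"
  shows "(cmod (weighting p (F v) j))\<^sup>2 \<le> c\<^sup>2 * (norm v)\<^sup>2"
proof (cases "v = 0 \<or> pmf p j = 0")
  case True
  have "weighting p (F 0) j = 0" using linear_0[OF linear_weighting[OF F]] .
  then show ?thesis using True by (auto simp: weighting_def)
next
  case False
  then have p: "0 < pmf p j" by (simp add: less_le)
  define u where "u = inverse (norm v) *\<^sub>R v"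
  have u: "u \<in> Delta T" "norm u = 1" using sub False by (auto simp: u_def)
  have "ereal (cmod (coord (F u) j)) \<le> local_coherence F T j"
    unfolding local_coherence_def using u by (intro Sup_upper) auto
  also have "\<dots> \<le> ereal c * ereal (sqrt (pmf p j))" using local_coherence_le[OF p, of F T] c by simp
  finally have "cmod (coord (F u) j) \<le> c * sqrt (pmf p j)" by simp
  then have "cmod (weighting p (F u) j) \<le> c"
    using p by (simp add: weighting_def norm_divide pos_divide_le_eq)
  moreover have "weighting p (F u) j = inverse (norm v) *\<^sub>R weighting p (F v) j"
    unfolding u_def by (rule linear_scale[OF linear_weighting[OF F]])
  ultimately have "cmod (weighting p (F v) j) \<le> c * norm v"
    using False by (simp add: field_simps)
  then show ?thesis using power_mono[of "cmod (weighting p (F v) j)" "c * norm v" 2]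
    by (simp add: power_mult_distrib)
qed

text \<open>The deviation bound with \<open>R = c\<^sup>2\<close>: coherence bounds each weighted
  coordinate, and the mean form is at most the squared norm because \<open>F\<close> is isometric
  and the support projection a contraction.\<close>

lemma sampling_deviation_on_subspace:
  assumes F: "unitary_op F" and c: "coherence_mu T F p = ereal c" "1 \<le> c"
    and D: "span D \<subseteq> Delta T" "D \<subseteq> span X" "finite X" "card X \<le> N"
    and I: "finite I" "I \<noteq> {}" and \<delta>: "0 < \<delta>" "\<delta> < 1"
  shows "measure_pmf.prob (Pi_pmf I dflt (\<lambda>_. p)) {f. \<exists>v\<in>span D. norm v = 1 \<and>
      \<delta> < \<bar>1 / real (card I) * (\<Sum>i\<in>I. (cmod (weighting p (F v) (f i)))\<^sup>2) - (norm (support_proj p (F v)))\<^sup>2\<bar>}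
    \<le> 2 * real N * exp (- (real (card I) * \<delta>\<^sup>2 / (4 * c\<^sup>2)))"
proof -
  obtain B where B: "finite B" "\<forall>b\<in>B. \<forall>c\<in>B. inner b c = (if b = c then 1 else 0)"
      "span B = span D" "card B \<le> card X"
    using orthonormal_basis_of_span[OF D(3,2)] by auto
  interpret onb B using B by unfold_locales auto
  have bound: "(cmod (weighting p (F v) j))\<^sup>2 \<le> c\<^sup>2 * (norm v)\<^sup>2" if "v \<in> span B" for v j
    using that B(3) D(1) c by (intro weighting_coherence_bound[OF F]) (auto intro: span_scale)
  have mean: "measure_pmf.expectation p (\<lambda>j. (cmod (weighting p (F v) j))\<^sup>2) \<le> (norm v)\<^sup>2" for v
    using norm_support_proj_le[of p "F v"] by (simp add: expectation_weighting norm_unitary[OF F])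
  have "1 \<le> c\<^sup>2" using c(2) by simp
  then have "measure_pmf.prob (Pi_pmf I dflt (\<lambda>_. p)) {f. \<exists>v\<in>span B. norm v = 1 \<and>
      \<delta> < \<bar>1 / real (card I) * (\<Sum>i\<in>I. (cmod (weighting p (F v) (f i)))\<^sup>2)
        - measure_pmf.expectation p (\<lambda>j. (cmod (weighting p (F v) j))\<^sup>2)\<bar>}
    \<le> 2 * real (card B) * exp (- (real (card I) * \<delta>\<^sup>2 / (4 * c\<^sup>2)))"
    by (intro prob_sampling_deviation[of "\<lambda>j v. weighting p (F v) j"] linear_weighting F bound mean I \<delta>)
  also have "\<dots> \<le> 2 * real N * exp (- (real (card I) * \<delta>\<^sup>2 / (4 * c\<^sup>2)))"
    using B(4) D(4) by (intro mult_right_mono mult_left_mono) auto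
  finally show ?thesis by (simp only: expectation_weighting B(3))
qed

section \<open>Finiteness of the coherence and the final union bound\<close>

lemma generative_network_widths:
  assumes "generative_network k d n G"
  shows "2 \<le> k" "k \<le> n d"
proof -
  have n: "2 \<le> k" "n 0 = k" "\<And>i. i < d \<Longrightarrow> n i \<le> n (Suc i)"
    using assms by (auto simp: generative_network_def)
  have "k \<le> n i" if "i \<le> d" for i
    using that by (induction i) (use n in \<open>auto intro: order_trans\<close>)
  then show "2 \<le> k" "k \<le> n d" using n by auto
qed

text \<open>An infinite coherence would make the lower bound on \<open>m\<close> infinite;
  positivity of \<open>L\<close> excludes the product of zero and infinity.\<close>

lemma coherence_mu_finite:
  assumes "1 \<le> \<mu>" "0 < \<delta>" "0 < L" and bound: "4 * \<mu>\<^sup>2 / ereal (\<delta>\<^sup>2) * ereal L \<le> ereal m"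
  obtains c where "\<mu> = ereal c" "1 \<le> c" "4 * c\<^sup>2 / \<delta>\<^sup>2 * L \<le> m"
proof (cases \<mu>)
  case (real c)
  have "4 * c\<^sup>2 / \<delta>\<^sup>2 * L \<le> m"
    using bound real assms(2) by (simp add: power2_eq_square divide_ereal_def divide_inverse mult_ac)
  then show ?thesis using assms(1) real that[of c] by simp
next
  case PInf
  have "(4 * \<infinity>\<^sup>2 / ereal (\<delta>\<^sup>2) * ereal L :: ereal) = \<infinity>"
    using assms by (simp add: power2_eq_square divide_ereal_def)
  then show ?thesis using bound PInf by simp
next
  case MInf
  then show ?thesis using assms by simp
qed

text \<open>The logarithm of the number of cones and that of the single-cone prefactor over
  \<open>\<epsilon>\<close> are exactly what the exponent has to absorb.\<close>

lemma union_bound_le_eps: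
  assumes k: "0 < k" and x: "0 < x" and e: "0 < \<epsilon>"
    and N: "N \<le> x ^ q" and t: "real q * ln x + ln (2 * k / \<epsilon>) \<le> t"
  shows "N * (2 * k * exp (- t)) \<le> (\<epsilon> :: real)"
proof -
  have "exp (- t) \<le> exp (- (real q * ln x + ln (2 * k / \<epsilon>)))" using t by simp
  also have "\<dots> = inverse (x ^ q) * (\<epsilon> / (2 * k))"
    using k x e by (simp add: exp_diff exp_minus exp_of_nat_mult field_simps exp_add)
  finally have 1: "exp (- t) \<le> inverse (x ^ q) * (\<epsilon> / (2 * k))" .
  have "N * (2 * k * exp (- t)) \<le> x ^ q * (2 * k * (inverse (x ^ q) * (\<epsilon> / (2 * k))))"
    using N 1 k x by (intro mult_mono mult_left_mono) auto
  also have "\<dots> = \<epsilon>" using k x by simp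
  finally show ?thesis .
qed

theorem theorem4p7:
  fixes F :: "ell2 \<Rightarrow> ell2" and p :: "nat pmf" and m k d :: nat and n :: "nat \<Rightarrow> nat"
    and G :: "real Matrix.vec \<Rightarrow> ell2" and T :: "ell2 set" and \<epsilon> \<delta> :: real
    and M :: "'a measure" and s :: "nat \<Rightarrow> 'a \<Rightarrow> ell2"
  assumes F: "unitary_op F"
    and m: "1 \<le> m"
    and M: "prob_space M"
    and s_indep: "prob_space.indep_vars M (\<lambda>_. borel) s {1..m}"
    and s_distr: "\<And>i j. i \<in> {1..m} \<Longrightarrow>
                    measure M {\<omega> \<in> space M. s i \<omega> = basis_vec j} = pmf p j"
    and G: "generative_network k d n G"
    and T: "T = {a - b | a b. a \<in> G ` carrier_vec k \<and> b \<in> G ` carrier_vec k}"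
    and eps: "0 < \<epsilon>"
    and delta: "0 < \<delta>" "\<delta> < 1"
    and mu: "1 \<le> coherence_mu T F p"
    and m_bound: "4 * (coherence_mu T F p)\<^sup>2 / ereal (\<delta>\<^sup>2) *
           ereal (2 * real k * real d * ln (2 * exp 1 * real (n d) / real k)
                  + ln (4 * real k / \<epsilon>)) \<le> ereal (real m)"
  shows "measure M {\<omega> \<in> space M.
           (SUP x\<in>{x \<in> T. norm x = 1}.
              ereal \<bar>1 / real m * (L2_set (\<lambda>i. cmod (sampling (\<lambda>i. s i \<omega>) (weighting p (F x)) i)) {1..m})\<^sup>2
                     - (norm (support_proj p (F x)))\<^sup>2\<bar>) \<le> ereal \<delta>} \<ge> 1 - \<epsilon>"
proof (cases "1 \<le> \<epsilon>")
  case True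
  then show ?thesis by (intro order_trans[OF _ measure_nonneg]) simp
next
  case False
  define x where "x = 2 * exp 1 * real (n d) / real k"
  define L where "L = 2 * real k * real d * ln x + ln (4 * real k / \<epsilon>)"
  note k = generative_network_widths[OF G]
  have x: "1 \<le> x" "exp 1 * real (n d) / real k \<le> x"
  proof -
    have "1 * 1 \<le> exp 1 * (real (n d) / real k)" using k by (intro mult_mono) auto
    moreover have "x = 2 * (exp 1 * (real (n d) / real k))"
      "exp 1 * real (n d) / real k = exp 1 * (real (n d) / real k)" by (simp_all add: x_def)
    ultimately show "1 \<le> x" "exp 1 * real (n d) / real k \<le> x" by linarith+
  qed
  \<comment> \<open>Since \<open>\<epsilon> < 1\<close> in this case, the second logarithm is
    positive, and so is \<open>L\<close>.\<close>
  have "1 < 4 * real k / \<epsilon>" using k eps False by (simp add: pos_less_divide_eq)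
  then have L: "0 < L" unfolding L_def using x by (intro add_nonneg_pos mult_nonneg_nonneg) auto
  obtain c where c: "coherence_mu T F p = ereal c" "1 \<le> c" "4 * c\<^sup>2 / \<delta>\<^sup>2 * L \<le> real m"
    using coherence_mu_finite[OF mu delta(1) L] m_bound unfolding L_def x_def by blast
  obtain \<D> where \<D>: "cone_decomposition \<D> T"
      "real (card \<D>) \<le> (exp 1 * real (n d) / real k) ^ (2 * k * d)"
      "\<forall>D\<in>\<D>. \<exists>X. finite X \<and> card X \<le> 2 * k \<and> D \<subseteq> span X"
    using network_differences_cones[OF G T] by blast
  have finD: "finite \<D>" and T_eq: "T = \<Union>\<D>" using \<D>(1) by (auto simp: cone_decomposition_def)

  let ?P = "Pi_pmf {1..m} 0 (\<lambda>_. p)"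
  define Bad where "Bad D = {f. \<exists>v\<in>span D. norm v = 1 \<and>
      \<delta> < \<bar>1 / real (card {1..m}) * (\<Sum>i\<in>{1..m}. (cmod (weighting p (F v) (f i)))\<^sup>2)
        - (norm (support_proj p (F v)))\<^sup>2\<bar>}" for D
  define b where "b = 2 * real (2 * k) * exp (- (real m * \<delta>\<^sup>2 / (4 * c\<^sup>2)))"
  have Bad: "measure_pmf.prob ?P (Bad D) \<le> b" if D: "D \<in> \<D>" for D
  proof -
    obtain X where "finite X" "card X \<le> 2 * k" "D \<subseteq> span X" using \<D>(3) D by blast
    moreover have "span D \<subseteq> Delta T"
      unfolding Delta_eq[OF \<D>(1)] using real_span_subset_complex_span D by blast
    ultimately show ?thesis
      unfolding Bad_def b_def using sampling_deviation_on_subspace[OF F c(1,2), of D X "2 * k" "{1..m}" \<delta> 0] m delta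
      by simp
  qed
  \<comment> \<open>The event is phrased through the indices alone, so the same predicate applies to
    the abstract sample and to the discrete product.\<close>
  define Ev where "Ev g \<longleftrightarrow> (SUP x\<in>{x \<in> T. norm x = 1}.
      ereal \<bar>1 / real m * (L2_set (\<lambda>i. cmod (case g i of Some j \<Rightarrow> weighting p (F x) j | None \<Rightarrow> 0)) {1..m})\<^sup>2
        - (norm (support_proj p (F x)))\<^sup>2\<bar>) \<le> ereal \<delta>" for g
  have L2: "L2_set (\<lambda>i. cmod (sampling (\<lambda>i. s i \<omega>) y i)) {1..m}
      = L2_set (\<lambda>i. cmod (case (\<lambda>i\<in>{1..m}. basis_index (s i \<omega>)) i of Some j \<Rightarrow> y j | None \<Rightarrow> 0)) {1..m}" for \<omega> y
    by (intro L2_set_cong) (simp_all add: sampling_eq_basis_index)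
  have "{f. \<not> Ev (\<lambda>i\<in>{1..m}. Some (f i))} \<subseteq> (\<Union>D\<in>\<D>. Bad D)"
  proof (rule subsetI, rule ccontr)
    fix f assume f: "f \<in> {f. \<not> Ev (\<lambda>i\<in>{1..m}. Some (f i))}" and good: "f \<notin> (\<Union>D\<in>\<D>. Bad D)"
    have "Ev (\<lambda>i\<in>{1..m}. Some (f i))" unfolding Ev_def
    proof (rule SUP_least)
      fix v assume v: "v \<in> {v \<in> T. norm v = 1}"
      then obtain D where D: "D \<in> \<D>" "v \<in> span D" using T_eq span_base by blast
      have "L2_set (\<lambda>i. cmod (case (\<lambda>i\<in>{1..m}. Some (f i)) i of Some j \<Rightarrow> weighting p (F v) j | None \<Rightarrow> 0)) {1..m}
          = L2_set (\<lambda>i. cmod (weighting p (F v) (f i))) {1..m}"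
        by (intro L2_set_cong) simp_all
      also have "\<dots>\<^sup>2 = (\<Sum>i\<in>{1..m}. (cmod (weighting p (F v) (f i)))\<^sup>2)"
        by (simp add: L2_set_def sum_nonneg)
      finally show "ereal \<bar>1 / real m * (L2_set (\<lambda>i. cmod (case (\<lambda>i\<in>{1..m}. Some (f i)) i of
            Some j \<Rightarrow> weighting p (F v) j | None \<Rightarrow> 0)) {1..m})\<^sup>2 - (norm (support_proj p (F v)))\<^sup>2\<bar> \<le> ereal \<delta>"
        using good D v by (auto simp: Bad_def not_less)
    qed
    then show False using f by simp
  qed
  then have "measure_pmf.prob ?P {f. \<not> Ev (\<lambda>i\<in>{1..m}. Some (f i))} \<le> measure_pmf.prob ?P (\<Union>D\<in>\<D>. Bad D)"
    by (intro measure_pmf.finite_measure_mono) auto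
  also have "\<dots> \<le> (\<Sum>D\<in>\<D>. measure_pmf.prob ?P (Bad D))"
    by (intro measure_pmf.finite_measure_subadditive_finite finD) auto
  also have "\<dots> \<le> real (card \<D>) * b" using sum_bounded_above[of \<D> "\<lambda>D. measure_pmf.prob ?P (Bad D)" b] Bad by simp
  also have "\<dots> \<le> \<epsilon>" unfolding b_def
  proof (rule union_bound_le_eps)
    show "real (card \<D>) \<le> x ^ (2 * k * d)"
      using \<D>(2) x(2) by (elim order_trans) (intro power_mono, auto)
    \<comment> \<open>Solves the assumption on \<open>m\<close> for the exponent. With
      \<open>2 * k\<close> as the dimension, the prefactor \<open>2 * (2 * k)\<close> matches the
      \<open>4 * k\<close> in the logarithm.\<close>
    have "L = 4 * c\<^sup>2 / \<delta>\<^sup>2 * L * \<delta>\<^sup>2 / (4 * c\<^sup>2)" using c(2) delta by simp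
    also have "\<dots> \<le> real m * \<delta>\<^sup>2 / (4 * c\<^sup>2)" using c(3) by (intro divide_right_mono mult_right_mono) auto
    finally show "real (2 * k * d) * ln x + ln (2 * real (2 * k) / \<epsilon>) \<le> real m * \<delta>\<^sup>2 / (4 * c\<^sup>2)"
      by (simp add: L_def)
  qed (use k x eps in auto)
  finally have "1 - \<epsilon> \<le> 1 - measure_pmf.prob ?P {f. \<not> Ev (\<lambda>i\<in>{1..m}. Some (f i))}" by simp
  also have "\<dots> = measure_pmf.prob ?P {f. Ev (\<lambda>i\<in>{1..m}. Some (f i))}"
    using measure_pmf.prob_compl[of "{f. \<not> Ev (\<lambda>i\<in>{1..m}. Some (f i))}" ?P]
    by (simp add: Compl_eq_Diff_UNIV[symmetric] Collect_neg_eq[symmetric])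
  also have "\<dots> = measure M {\<omega> \<in> space M. Ev (\<lambda>i\<in>{1..m}. basis_index (s i \<omega>))}"
    using m by (intro sample_event_prob[symmetric] M s_indep s_distr) auto
  finally show ?thesis unfolding Ev_def L2 .
qed

end
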